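(* Let $\bar\epsilon$ be an over-estimate of the agent's Q-function error, i.e. $\bar\epsilon\ge\epsilon(t_a)$. The information advantage condition $$\Phi_{\min} > 2(1+\gamma)\,\bar\epsilon$$ is necessary and sufficient for the Bellman Deviation Detection algorithm (run with threshold $(1+\gamma)\bar\epsilon$) to guarantee attack detection while avoiding false alarms with high probability as $t_c\to\infty$, when the agent uses any arbitrary policy.
   Context: Setting. A finite MDP $(\mathcal X,\mathcal U,\mathbf P,\mathbf R,\gamma)$ with $|\mathcal X|=N$, $|\mathcal U|=M$, discount factor $\gamma\in[0,1)$; for each $(i,j)\in\mathcal X\times\mathcal U$, $\mathbf p_{i,j}$ is the row vector of transition probabilities $p(i,j,x')$ and $\mathbf r_{i,j}$ the row vector of rewards $r_{i,j}(x')$ (the reward depends on state, action and next state). Observed rewards are $r_{i,j}(x')+w$ with $w$ i.i.d. zero-mean noise (finite variance is not assumed). $Q^*$ is the optimal Q-function, $V^*(x)=\max_u Q^*(x,u)$, $\mathbf v=[V^*(x_1),\dots,V^*(x_N)]$; Bellman equation: $Q^*(i,j)=\mathbf p_{i,j}(\mathbf r_{i,j}+\gamma\mathbf v)^T$. Agent. Before detection, the agent has learned from a training trajectory of length $t_a$ an estimate $\hat Q$ with $|\hat Q(x,u)-Q^*(x,u)|\le\epsilon(t_a)$ for all $(x,u)$ w.h.p., where $\epsilon(t_a)\to0$ as $t_a\to\infty$; $\hat V(x)=\max_u\hat Q(x,u)$. Adversary. It has a transition model $\hat{\mathbf P}$ with rows $\hat{\mathbf p}_{i,j}$; $\tilde{\mathbf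 p}_{i,j}=\mathbf p_{i,j}-\hat{\mathbf p}_{i,j}$. When the system is secure, the next state fed back to the agent after $(i,j)$ is drawn from $\mathbf p_{i,j}$; when it is under attack, it is drawn from $\hat{\mathbf p}_{i,j}$. In both cases the agent receives the noisy reward for the transition it is shown. Minimum value drift: $\Phi_{\min}=\min_{(i,j)\in\mathcal X\times\mathcal U}|\tilde{\mathbf p}_{i,j}(\mathbf r_{i,j}+\gamma\mathbf v)^T|$. Bellman Deviation Detection algorithm. Input: the trajectory $\boldsymbol\tau_c=(x_1,u_1,\dots,x_{t_c},u_{t_c})$ observed in the detection phase. Let $t_c(i,j)$ be the number of visits to $(i,j)$, and for the $k$-th visit let $x_{i,j}(k)$ be the next state and $w_{i,j}(k)$ the reward noise. Put $d_{i,j}(k)=\hat Q(i,j)-r_{i,j}(x_{i,j}(k))-w_{i,j}(k)-\gamma\hat V(x_{i,j}(k))$ and $\bar d_{i,j}=\frac1{t_c(i,j)}\sum_{k=1}^{t_c(i,j)}d_{i,j}(k)$. Discard all pairs with $t_c(i,j)\le \frac{t_c}{2|\mathcal X||\mathcal U|}$. Declare a breach if the maximum of $|\bar d_{i,j}|$ over the remaining pairs exceeds $(1+\gamma)\bar\epsilon$; otherwise declare no breach. "Attack detection" means declaring a breach when under attack; a "false alarm" is declaring a breach when secure. An event occurs with high probability (w.h.p.) if its probability tends to $1$.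
   Formalization: False alarms are excluded only when, almost surely, no pair's expected secure deviation equals the threshold (1+γ)ε̄ exactly (the claim fails at such ties). Necessity is worst case: if the condition fails, some problem with the same Φ_min, γ and ε̄ evades detection. *)

theory Defs
  imports "HOL-Probability.Probability"
begin

text \<open>
  States and actions are the elements of finite types \<open>'x\<close>, \<open>'u\<close>. A transition model assigns to each
  pair a probability mass function, and \<open>r x u x'\<close> is the reward for the transition from \<open>x\<close> to
  \<open>x'\<close> under \<open>u\<close>.
\<close>

type_synonym ('x, 'u) kernel = "'x \<Rightarrow> 'u \<Rightarrow> 'x pmf"
type_synonym ('x, 'u) rewards = "'x \<Rightarrow> 'u \<Rightarrow> 'x \<Rightarrow> real"
type_synonym ('x, 'u) qfun = "'x \<Rightarrow> 'u \<Rightarrow> real"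

text \<open>History-dependent randomised policies; the list holds the past state-action pairs, oldest first.\<close>

type_synonym ('x, 'u) policy = "('x \<times> 'u) list \<Rightarrow> 'x \<Rightarrow> 'u pmf"

definition row_dot :: "'x::finite pmf \<Rightarrow> ('x \<Rightarrow> real) \<Rightarrow> real" where
  "row_dot q f = (\<Sum>x'\<in>UNIV. pmf q x' * f x')"

text \<open>Expected discounted reward over the next \<open>n\<close> steps, from history \<open>h\<close> and current state \<open>x\<close>.\<close>

primrec policy_return ::
  "real \<Rightarrow> ('x::finite, 'u::finite) kernel \<Rightarrow> ('x, 'u) rewards \<Rightarrow> ('x, 'u) policy \<Rightarrow>
    nat \<Rightarrow> ('x \<times> 'u) list \<Rightarrow> 'x \<Rightarrow> real" where
  "policy_return \<gamma> p r \<pi> 0 h x = 0"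
| "policy_return \<gamma> p r \<pi> (Suc n) h x =
     (\<Sum>u\<in>UNIV. pmf (\<pi> h x) u *
        row_dot (p x u) (\<lambda>x'. r x u x' + \<gamma> * policy_return \<gamma> p r \<pi> n (h @ [(x, u)]) x'))"

definition policy_q ::
  "real \<Rightarrow> ('x::finite, 'u::finite) kernel \<Rightarrow> ('x, 'u) rewards \<Rightarrow> ('x, 'u) policy \<Rightarrow> ('x, 'u) qfun" where
  "policy_q \<gamma> p r \<pi> x u =
     lim (\<lambda>n. row_dot (p x u) (\<lambda>x'. r x u x' + \<gamma> * policy_return \<gamma> p r \<pi> n [(x, u)] x'))"

definition Qstar ::
  "real \<Rightarrow> ('x::finite, 'u::finite) kernel \<Rightarrow> ('x, 'u) rewards \<Rightarrow> ('x, 'u) qfun" where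
  "Qstar \<gamma> p r x u = (SUP \<pi>. policy_q \<gamma> p r \<pi> x u)"

definition vmax :: "('x, 'u::finite) qfun \<Rightarrow> 'x \<Rightarrow> real" where
  "vmax Q x = Max (range (Q x))"

definition Phi_min ::
  "real \<Rightarrow> ('x::finite, 'u::finite) kernel \<Rightarrow> ('x, 'u) rewards \<Rightarrow> ('x, 'u) kernel \<Rightarrow> real" where
  "Phi_min \<gamma> p r phat =
     Min (range (\<lambda>(i, j).
       \<bar>\<Sum>x'\<in>UNIV. (pmf (p i j) x' - pmf (phat i j) x') * (r i j x' + \<gamma> * vmax (Qstar \<gamma> p r) x')\<bar>))"

definition zero_mean_noise :: "real measure \<Rightarrow> bool" where
  "zero_mean_noise \<nu> \<longleftrightarrow>
     prob_space \<nu> \<and> sets \<nu> = sets borel \<and> integrable \<nu> (\<lambda>w. w) \<and> (LINT w|\<nu>. w) = 0"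

text \<open>
  The detection phase under an arbitrary policy. \<open>F t\<close> is the information available when the action
  at time \<open>t\<close> has been chosen; the policy is unrestricted except that \<open>U t\<close> is \<open>F t\<close>-measurable, so
  it may depend on all past states, actions and noisy rewards and on private randomisation. Given
  \<open>F t\<close>, the next state shown to the agent has law \<open>K (X t) (U t)\<close> and the reward noise \<open>W t\<close> is an
  independent draw from \<open>\<nu>\<close>. \<open>K\<close> is the true model when secure, the adversary's model under attack.
\<close>

definition controlled_process ::
  "('x::finite, 'u::finite) kernel \<Rightarrow> real measure \<Rightarrow> 'w measure \<Rightarrow> (nat \<Rightarrow> 'w measure) \<Rightarrow>
    (nat \<Rightarrow> 'w \<Rightarrow> 'x) \<Rightarrow> (nat \<Rightarrow> 'w \<Rightarrow> 'u) \<Rightarrow> (nat \<Rightarrow> 'w \<Rightarrow> real) \<Rightarrow> bool" where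
  "controlled_process K \<nu> M F X U W \<longleftrightarrow>
     prob_space M \<and> filtration (space M) F \<and> (\<forall>t. subalgebra M (F t)) \<and>
     (\<forall>t. X t \<in> F t \<rightarrow>\<^sub>M count_space UNIV) \<and>
     (\<forall>t. U t \<in> F t \<rightarrow>\<^sub>M count_space UNIV) \<and>
     (\<forall>t. W t \<in> F (Suc t) \<rightarrow>\<^sub>M borel) \<and>
     (\<forall>t x u x'. \<forall>A\<in>sets (F t). \<forall>B\<in>sets borel.
        measure M {\<omega>\<in>A. X t \<omega> = x \<and> U t \<omega> = u \<and> X (Suc t) \<omega> = x' \<and> W t \<omega> \<in> B} =
        measure M {\<omega>\<in>A. X t \<omega> = x \<and> U t \<omega> = u} * pmf (K x u) x' * measure \<nu> B)"

definition estimate_ok :: "('x, 'u) qfun \<Rightarrow> ('x, 'u) qfun \<Rightarrow> real \<Rightarrow> bool" where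
  "estimate_ok Q Qhat e \<longleftrightarrow> (\<forall>x u. \<bar>Qhat x u - Q x u\<bar> \<le> e)"

text \<open>\<open>Qhat ta\<close> is the (random) estimate learned from a training trajectory of length \<open>ta\<close>.\<close>

definition learned_estimates ::
  "'w measure \<Rightarrow> ('x, 'u) qfun \<Rightarrow> (nat \<Rightarrow> 'w \<Rightarrow> ('x, 'u) qfun) \<Rightarrow> (nat \<Rightarrow> real) \<Rightarrow> bool" where
  "learned_estimates M Q Qhat \<epsilon> \<longleftrightarrow>
     (\<forall>ta x u. (\<lambda>\<omega>. Qhat ta \<omega> x u) \<in> borel_measurable M) \<and>
     \<epsilon> \<longlonglongrightarrow> 0 \<and>
     (\<lambda>ta. \<P>(\<omega> in M. estimate_ok Q (Qhat ta \<omega>) (\<epsilon> ta))) \<longlonglongrightarrow> 1"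

text \<open>
  One run of the detection algorithm on a sample path \<open>x\<close>, \<open>u\<close>, \<open>w\<close> of length \<open>t\<close>, with
  time starting at \<open>0\<close>. Visits to a pair are indexed by the times at which they occur.
\<close>

definition visits :: "(nat \<Rightarrow> 'x) \<Rightarrow> (nat \<Rightarrow> 'u) \<Rightarrow> nat \<Rightarrow> 'x \<Rightarrow> 'u \<Rightarrow> nat set" where
  "visits x u t i j = {s. s < t \<and> x s = i \<and> u s = j}"

definition mean_deviation ::
  "real \<Rightarrow> ('x, 'u::finite) rewards \<Rightarrow> ('x, 'u) qfun \<Rightarrow>
    (nat \<Rightarrow> 'x) \<Rightarrow> (nat \<Rightarrow> 'u) \<Rightarrow> (nat \<Rightarrow> real) \<Rightarrow> nat \<Rightarrow> 'x \<Rightarrow> 'u \<Rightarrow> real" where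
  "mean_deviation \<gamma> r Qhat x u w t i j =
     (\<Sum>s\<in>visits x u t i j. Qhat i j - r i j (x (Suc s)) - w s - \<gamma> * vmax Qhat (x (Suc s)))
       / real (card (visits x u t i j))"

definition retained :: "(nat \<Rightarrow> 'x::finite) \<Rightarrow> (nat \<Rightarrow> 'u::finite) \<Rightarrow> nat \<Rightarrow> ('x \<times> 'u) set" where
  "retained x u t =
     {(i, j). real (card (visits x u t i j)) > real t / (2 * real CARD('x) * real CARD('u))}"

text \<open>For \<open>t > 0\<close> some pair is always retained, so the maximum is then over a nonempty set.\<close>

definition declares_breach ::
  "real \<Rightarrow> ('x::finite, 'u::finite) rewards \<Rightarrow> real \<Rightarrow> ('x, 'u) qfun \<Rightarrow>
    (nat \<Rightarrow> 'x) \<Rightarrow> (nat \<Rightarrow> 'u) \<Rightarrow> (nat \<Rightarrow> real) \<Rightarrow> nat \<Rightarrow> bool" where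
  "declares_breach \<gamma> r thr Qhat x u w t \<longleftrightarrow>
     Max ((\<lambda>(i, j). \<bar>mean_deviation \<gamma> r Qhat x u w t i j\<bar>) ` retained x u t) > thr"

definition expected_deviation ::
  "real \<Rightarrow> ('x::finite, 'u::finite) kernel \<Rightarrow> ('x, 'u) rewards \<Rightarrow> ('x, 'u) qfun \<Rightarrow> 'x \<Rightarrow> 'u \<Rightarrow> real" where
  "expected_deviation \<gamma> K r Qhat i j =
     Qhat i j - row_dot (K i j) (\<lambda>x'. r i j x' + \<gamma> * vmax Qhat x')"

text \<open>
  Both probabilities are conditional on the event that training achieved its error bound, which for
  a fixed training length only has probability close to \<open>1\<close>. \<open>Qhat ta\<close> is \<open>F 0\<close>-measurable because
  training precedes detection.

  The almost-sure condition in the secure case excludes only the exact tie in which the expected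
  deviation of some pair equals the threshold. It holds automatically when \<open>\<epsilon> ta < \<epsilon>bar\<close>, because
  secure expected deviations are at most \<open>(1 + \<gamma>) * \<epsilon> ta\<close> in absolute value. At a tie the sample
  mean fluctuates around the threshold, and the false alarm probability need not vanish.
\<close>

definition breach_guarantee ::
  "'w itself \<Rightarrow> real \<Rightarrow> ('x::finite, 'u::finite) kernel \<Rightarrow> ('x, 'u) rewards \<Rightarrow> ('x, 'u) kernel \<Rightarrow>
    real \<Rightarrow> bool" where
  "breach_guarantee sample_space \<gamma> p r phat \<epsilon>bar \<longleftrightarrow>
     (\<forall>\<nu> (M :: 'w measure) F X U W Qhat \<epsilon> ta.
        zero_mean_noise \<nu> \<longrightarrow>
        learned_estimates M (Qstar \<gamma> p r) Qhat \<epsilon> \<longrightarrow>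
        (\<forall>i j. (\<lambda>\<omega>. Qhat ta \<omega> i j) \<in> borel_measurable (F 0)) \<longrightarrow>
        \<P>(\<omega> in M. estimate_ok (Qstar \<gamma> p r) (Qhat ta \<omega>) (\<epsilon> ta)) > 0 \<longrightarrow>
        \<epsilon> ta \<le> \<epsilon>bar \<longrightarrow>
        (controlled_process phat \<nu> M F X U W \<longrightarrow>
           (\<lambda>tc. \<P>(\<omega> in M.
              declares_breach \<gamma> r ((1 + \<gamma>) * \<epsilon>bar) (Qhat ta \<omega>) (\<lambda>s. X s \<omega>) (\<lambda>s. U s \<omega>) (\<lambda>s. W s \<omega>) tc
              \<bar> estimate_ok (Qstar \<gamma> p r) (Qhat ta \<omega>) (\<epsilon> ta))) \<longlonglongrightarrow> 1) \<and>
        (controlled_process p \<nu> M F X U W \<longrightarrow>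
         (AE \<omega> in M. estimate_ok (Qstar \<gamma> p r) (Qhat ta \<omega>) (\<epsilon> ta) \<longrightarrow>
            (\<forall>i j. \<bar>expected_deviation \<gamma> p r (Qhat ta \<omega>) i j\<bar> \<noteq> (1 + \<gamma>) * \<epsilon>bar)) \<longrightarrow>
           (\<lambda>tc. \<P>(\<omega> in M.
              declares_breach \<gamma> r ((1 + \<gamma>) * \<epsilon>bar) (Qhat ta \<omega>) (\<lambda>s. X s \<omega>) (\<lambda>s. U s \<omega>) (\<lambda>s. W s \<omega>) tc
              \<bar> estimate_ok (Qstar \<gamma> p r) (Qhat ta \<omega>) (\<epsilon> ta))) \<longlonglongrightarrow> 0))"

end

theory Submission
  imports Defs
begin

text \<open>
  Since \<open>Qstar\<close> satisfies the Bellman equation, an estimate with error at most \<open>e\<close> has expected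
  deviations within \<open>(1 + \<gamma>) * e\<close> of \<open>0\<close> when secure and, under attack, within \<open>(1 + \<gamma>) * e\<close> of a
  value drift of absolute value at least \<open>Phi_min\<close>. At a retained pair the number of visits is
  proportional to \<open>t\<close>, so the sample deviation approaches the expected one as soon as martingale
  difference sums over the visits are \<open>o(t)\<close> in probability. This holds under every policy:
  bounded differences are orthogonal, and the merely integrable noise is truncated. The estimate
  enters only through finitely many bounded coefficients of these sums, so its randomness does no
  harm. Conversely, without the advantage the estimation error can cancel enough of the drift.
\<close>

subsection \<open>The Bellman equation\<close>

text \<open>The two halves of the guarantee have different margins. Under attack the strict
  inequality leaves a gap between every expected deviation and the threshold, uniform over all
  estimates with the permitted error. When secure, expected deviations may come arbitrarily close to
  the threshold from below, so a margin is available only up to an event of small probability. The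
  number of visits to a pair is random and controlled by the policy. Instead of treating the k-th
  visit as a stopping time, sums run over a fixed time range with visit indicators as weights and
  are compared with \<open>t\<close>; the discarding rule then turns \<open>o(t)\<close> into a
  small error per visit. The exceptional event is fixed before the estimate: outside it the bound
  holds for all admissible estimates at once, in particular for the random one. \<open>Qstar\<close>
  is a supremum over history-dependent policies, so its Bellman equation has to be derived.\<close>

lemma row_dot_mono: "(\<And>y. f y \<le> g y) \<Longrightarrow> row_dot q f \<le> row_dot q g"
  unfolding row_dot_def by (intro sum_mono mult_left_mono) auto

lemma row_dot_add_const: "row_dot q (\<lambda>y. f y + c) = row_dot q f + c"
  by (simp add: row_dot_def distrib_left sum.distrib flip: sum_distrib_right)
     (simp add: sum_pmf_eq_1)

lemma row_dot_diff: "row_dot q (\<lambda>y. f y - g y) = row_dot q f - row_dot q g"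
  by (simp add: row_dot_def right_diff_distrib sum_subtractf)

lemma row_dot_return: "row_dot (return_pmf y) f = f y"
  by (simp add: row_dot_def pmf_return indicator_def if_distrib[where f="\<lambda>x. x * _"] cong: if_cong)

lemma abs_row_dot_le:
  assumes "\<And>y. \<bar>f y\<bar> \<le> c"
  shows "\<bar>row_dot q f\<bar> \<le> c"
proof -
  have "row_dot q f \<le> row_dot q (\<lambda>y. 0 + c)" "row_dot q (\<lambda>y. 0 + (- c)) \<le> row_dot q f"
    using assms by (intro row_dot_mono; simp add: abs_le_iff minus_le_iff)+
  then show ?thesis
    unfolding row_dot_add_const by (auto simp: row_dot_def abs_le_iff)
qed

lemma vmax_ge: "Q x u \<le> vmax Q x"
  by (simp add: vmax_def)

lemma vmax_attained: obtains u where "vmax Q x = Q x u"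
proof -
  have "Max (range (Q x)) \<in> range (Q x)" by (rule Max_in) auto
  then show thesis using that by (force simp: vmax_def)
qed

lemma vmax_le: "(\<And>u. Q x u \<le> c) \<Longrightarrow> vmax Q x \<le> c"
  by (metis vmax_attained)

lemma abs_vmax_diff_le:
  assumes "\<And>u. \<bar>Q x u - Q' x u\<bar> \<le> c"
  shows "\<bar>vmax Q x - vmax Q' x\<bar> \<le> c"
proof -
  have "vmax Q x \<le> vmax Q' x + c"
    by (rule vmax_le) (smt (verit) assms vmax_ge)
  moreover have "vmax Q' x \<le> vmax Q x + c"
    by (rule vmax_le) (smt (verit) assms vmax_ge)
  ultimately show ?thesis by linarith
qed

text \<open>Serves both the iterates of the Bellman operator and the finite-horizon returns of a
  policy, whose increments shrink by the discount factor in each step.\<close>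

lemma convergent_if_geometric_increments:
  fixes a :: "nat \<Rightarrow> real"
  assumes "0 \<le> g" "g < 1" "\<And>n. \<bar>a (Suc n) - a n\<bar> \<le> g ^ n * D"
  shows "convergent a"
proof -
  have "summable (\<lambda>n. a (Suc n) - a n)"
    by (rule summable_comparison_test'[where g="\<lambda>n. g ^ n * D" and N=0])
       (use assms in \<open>auto intro!: summable_mult2 summable_geometric\<close>)
  then have "convergent (\<lambda>n. \<Sum>k<n. a (Suc k) - a k)"
    by (simp add: summable_iff_convergent)
  then have "convergent (\<lambda>n. a n - a 0)"
    by (simp add: sum_lessThan_telescope)
  then have "convergent (\<lambda>n. (a n - a 0) + a 0)"
    by (intro convergent_add convergent_const)
  then show ?thesis by simp
qed

lemma finite_family_bounded:
  fixes f :: "'a::finite \<Rightarrow> real"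
  obtains B where "\<And>a. \<bar>f a\<bar> \<le> B"
  using that[of "Max (range (\<lambda>a. \<bar>f a\<bar>))"] by (simp add: Max_ge)

definition bellman ::
  "real \<Rightarrow> ('x::finite, 'u::finite) kernel \<Rightarrow> ('x, 'u) rewards \<Rightarrow> ('x, 'u) qfun \<Rightarrow> ('x, 'u) qfun" where
  "bellman \<gamma> p r Q x u = row_dot (p x u) (\<lambda>y. r x u y + \<gamma> * vmax Q y)"

text \<open>Averaging and maximisation are both non-expansive in the supremum norm, so only the
  discount remains. The kernel is arbitrary: the same estimate later bounds the effect of estimation
  errors under the adversary's model.\<close>

lemma bellman_contraction:
  assumes "0 \<le> \<gamma>" "\<And>x u. \<bar>Q x u - Q' x u\<bar> \<le> c"
  shows "\<bar>bellman \<gamma> p r Q x u - bellman \<gamma> p r Q' x u\<bar> \<le> \<gamma> * c"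
proof -
  have "\<bar>row_dot (p x u) (\<lambda>y. (r x u y + \<gamma> * vmax Q y) - (r x u y + \<gamma> * vmax Q' y))\<bar> \<le> \<gamma> * c"
  proof (rule abs_row_dot_le)
    fix y
    have "\<bar>\<gamma> * (vmax Q y - vmax Q' y)\<bar> \<le> \<gamma> * c"
      using assms by (simp add: abs_mult mult_left_mono abs_vmax_diff_le)
    then show "\<bar>(r x u y + \<gamma> * vmax Q y) - (r x u y + \<gamma> * vmax Q' y)\<bar> \<le> \<gamma> * c"
      by (simp add: algebra_simps)
  qed
  then show ?thesis by (simp only: row_dot_diff bellman_def)
qed

text \<open>Value iteration from zero; with finitely many pairs, pointwise convergence suffices to
  pass to the limit in the recursion.\<close>

lemma bellman_fixed_point:
  fixes p :: "('x::finite, 'u::finite) kernel"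
  assumes "0 \<le> \<gamma>" "\<gamma> < 1"
  obtains Q where "bellman \<gamma> p r Q = Q"
proof -
  define q where "q n = (bellman \<gamma> p r ^^ n) (\<lambda>_ _. 0)" for n
  have q_Suc: "q (Suc n) = bellman \<gamma> p r (q n)" for n
    by (simp add: q_def)
  obtain D where D: "\<And>a. \<bar>(\<lambda>(x, u). q 1 x u) a\<bar> \<le> D"
    using finite_family_bounded by blast
  have inc: "\<bar>q (Suc n) x u - q n x u\<bar> \<le> \<gamma> ^ n * D" for n x u
  proof (induction n arbitrary: x u)
    case 0
    then show ?case using D[of "(x, u)"] by (simp add: q_def)
  next
    case (Suc n)
    then show ?case
      using bellman_contraction[OF assms(1), of "q (Suc n)" "q n" "\<gamma> ^ n * D"]
      by (simp add: q_Suc mult.assoc)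
  qed
  define Q where "Q x u = lim (\<lambda>n. q n x u)" for x u
  have lim: "(\<lambda>n. q n x u) \<longlonglongrightarrow> Q x u" for x u
    using convergent_if_geometric_increments[OF assms, of "\<lambda>n. q n x u", OF inc]
    by (simp add: Q_def convergent_LIMSEQ_iff)
  have "bellman \<gamma> p r Q x u = Q x u" for x u
  proof (rule LIMSEQ_unique)
    show "(\<lambda>n. q (Suc n) x u) \<longlonglongrightarrow> Q x u"
      using lim by (rule LIMSEQ_Suc)
    have "(\<lambda>n. vmax (q n) y) \<longlonglongrightarrow> vmax Q y" for y
    proof -
      \<comment> \<open>The sum of all coordinate errors dominates each of them, which supplies the
        bound uniform in the action that \<open>abs_vmax_diff_le\<close> asks for.\<close>
      have "(\<lambda>n. \<Sum>v\<in>UNIV. \<bar>q n y v - Q y v\<bar>) \<longlonglongrightarrow> (\<Sum>v\<in>(UNIV::'u set). \<bar>Q y v - Q y v\<bar>)"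
        by (intro tendsto_intros lim)
      then have *: "(\<lambda>n. \<Sum>v\<in>UNIV. \<bar>q n y v - Q y v\<bar>) \<longlonglongrightarrow> 0" by simp
      have "(\<lambda>n. vmax (q n) y - vmax Q y) \<longlonglongrightarrow> 0"
        by (rule Lim_null_comparison[OF _ *])
           (auto intro!: always_eventually abs_vmax_diff_le member_le_sum)
      then show ?thesis by (simp add: LIM_zero_iff)
    qed
    then show "(\<lambda>n. q (Suc n) x u) \<longlonglongrightarrow> bellman \<gamma> p r Q x u"
      unfolding q_Suc bellman_def row_dot_def by (intro tendsto_intros)
  qed
  then show thesis using that by blast
qed

section \<open>Finite-horizon returns of history-dependent policies\<close>

lemma pmf_average_le:
  fixes f :: "'u::finite \<Rightarrow> real"
  shows "(\<And>u. f u \<le> c) \<Longrightarrow> (\<Sum>u\<in>UNIV. pmf q u * f u) \<le> c"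
  using row_dot_mono[of f "\<lambda>_. 0 + c" q] unfolding row_dot_add_const by (simp add: row_dot_def)

text \<open>Lengthening the horizon by one adds only the last reward, discounted by
  \<open>\<gamma> ^ n\<close>. The induction is over all histories because the policy continues from
  a longer one.\<close>

lemma policy_return_increment:
  assumes "0 \<le> \<gamma>" "\<And>x u y. \<bar>r x u y\<bar> \<le> B"
  shows "\<bar>policy_return \<gamma> p r \<pi> (Suc n) h x - policy_return \<gamma> p r \<pi> n h x\<bar> \<le> \<gamma> ^ n * B"
proof (induction n arbitrary: h x)
  case 0
  have "\<bar>row_dot (\<pi> h x) (\<lambda>u. row_dot (p x u) (r x u))\<bar> \<le> B"
    using assms by (intro abs_row_dot_le)
  then show ?case by (simp add: row_dot_def[of "\<pi> h x"])
next
  case (Suc n)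
  let ?R = "\<lambda>n. policy_return \<gamma> p r \<pi> n"
  let ?b = "\<lambda>n u. row_dot (p x u) (\<lambda>y. r x u y + \<gamma> * ?R n (h @ [(x, u)]) y)"
  have eq: "?R (Suc m) h x = row_dot (\<pi> h x) (?b m)" for m
    by (simp add: row_dot_def[of "\<pi> h x"])
  have "\<bar>row_dot (\<pi> h x) (\<lambda>u. ?b (Suc n) u - ?b n u)\<bar> \<le> \<gamma> ^ Suc n * B"
  proof (rule abs_row_dot_le)
    fix u
    have "\<bar>row_dot (p x u) (\<lambda>y. (r x u y + \<gamma> * ?R (Suc n) (h @ [(x, u)]) y)
        - (r x u y + \<gamma> * ?R n (h @ [(x, u)]) y))\<bar> \<le> \<gamma> ^ Suc n * B"
    proof (rule abs_row_dot_le)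
      fix y
      have "\<bar>\<gamma> * (?R (Suc n) (h @ [(x, u)]) y - ?R n (h @ [(x, u)]) y)\<bar> \<le> \<gamma> * (\<gamma> ^ n * B)"
        unfolding abs_mult using assms(1) Suc.IH by (simp add: mult_left_mono del: policy_return.simps)
      then show "\<bar>(r x u y + \<gamma> * ?R (Suc n) (h @ [(x, u)]) y) - (r x u y + \<gamma> * ?R n (h @ [(x, u)]) y)\<bar>
          \<le> \<gamma> ^ Suc n * B"
        by (simp add: algebra_simps del: policy_return.simps)
    qed
    then show "\<bar>?b (Suc n) u - ?b n u\<bar> \<le> \<gamma> ^ Suc n * B"
      by (simp only: row_dot_diff)
  qed
  then show ?case by (simp only: row_dot_diff eq)
qed

lemma policy_return_convergent:
  fixes p :: "('x::finite, 'u::finite) kernel"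
  assumes "0 \<le> \<gamma>" "\<gamma> < 1"
  shows "convergent (\<lambda>n. policy_return \<gamma> p r \<pi> n h x)"
proof -
  obtain B where "\<And>a. \<bar>(\<lambda>(x, u, y). r x u y) a\<bar> \<le> B"
    using finite_family_bounded by blast
  then have "\<And>x u y. \<bar>r x u y\<bar> \<le> B" by (metis case_prod_conv)
  from policy_return_increment[of \<gamma> r B, OF assms(1) this] show ?thesis
    by (rule convergent_if_geometric_increments[OF assms])
qed

lemma policy_q_lim:
  fixes p :: "('x::finite, 'u::finite) kernel"
  assumes "0 \<le> \<gamma>" "\<gamma> < 1"
  shows "(\<lambda>n. row_dot (p x u) (\<lambda>y. r x u y + \<gamma> * policy_return \<gamma> p r \<pi> n [(x, u)] y))
    \<longlonglongrightarrow> policy_q \<gamma> p r \<pi> x u"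
proof -
  have "convergent (\<lambda>n. row_dot (p x u) (\<lambda>y. r x u y + \<gamma> * policy_return \<gamma> p r \<pi> n [(x, u)] y))"
    unfolding row_dot_def
    by (intro convergent_sum convergent_mult convergent_add convergent_const policy_return_convergent assms)
  then show ?thesis by (simp add: policy_q_def convergent_LIMSEQ_iff)
qed

text \<open>Backward induction: one Bellman step bounds the average over actions by the maximum. The
  term \<open>\<gamma> ^ n * C\<close> accounts for the continuation value, which the truncated
  return replaces by zero.\<close>

lemma policy_return_upper:
  assumes "0 \<le> \<gamma>" "bellman \<gamma> p r Q = Q" "\<And>x. \<bar>vmax Q x\<bar> \<le> C"
  shows "policy_return \<gamma> p r \<pi> n h x \<le> vmax Q x + \<gamma> ^ n * C"
proof (induction n arbitrary: h x)
  case 0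
  then show ?case using assms(3)[of x] by simp
next
  case (Suc n)
  show ?case unfolding policy_return.simps
  proof (rule pmf_average_le)
    fix u
    have "row_dot (p x u) (\<lambda>y. r x u y + \<gamma> * policy_return \<gamma> p r \<pi> n (h @ [(x, u)]) y)
        \<le> row_dot (p x u) (\<lambda>y. (r x u y + \<gamma> * vmax Q y) + \<gamma> ^ Suc n * C)"
    proof (rule row_dot_mono)
      fix y
      have "\<gamma> * policy_return \<gamma> p r \<pi> n (h @ [(x, u)]) y \<le> \<gamma> * (vmax Q y + \<gamma> ^ n * C)"
        using Suc assms(1) by (intro mult_left_mono)
      then show "r x u y + \<gamma> * policy_return \<gamma> p r \<pi> n (h @ [(x, u)]) y
          \<le> (r x u y + \<gamma> * vmax Q y) + \<gamma> ^ Suc n * C"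
        by (simp add: algebra_simps)
    qed
    also have "\<dots> = Q x u + \<gamma> ^ Suc n * C"
      unfolding row_dot_add_const by (metis assms(2) bellman_def)
    also have "\<dots> \<le> vmax Q x + \<gamma> ^ Suc n * C" by (simp add: vmax_ge)
    finally show "row_dot (p x u) (\<lambda>y. r x u y + \<gamma> * policy_return \<gamma> p r \<pi> n (h @ [(x, u)]) y)
        \<le> vmax Q x + \<gamma> ^ Suc n * C" .
  qed
qed

text \<open>For greedy actions the Bellman step loses nothing, so only the truncated continuation
  value separates the return from the fixed point.\<close>

lemma policy_return_greedy:
  assumes "0 \<le> \<gamma>" "bellman \<gamma> p r Q = Q" "\<And>x. \<bar>vmax Q x\<bar> \<le> C"
    and greedy: "\<And>x. Q x (g x) = vmax Q x"
  shows "vmax Q x - \<gamma> ^ n * C \<le> policy_return \<gamma> p r (\<lambda>h x. return_pmf (g x)) n h x"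
proof (induction n arbitrary: h x)
  case 0
  then show ?case using assms(3)[of x] by simp
next
  case (Suc n)
  let ?R = "policy_return \<gamma> p r (\<lambda>h x. return_pmf (g x)) n (h @ [(x, g x)])"
  have "vmax Q x - \<gamma> ^ Suc n * C = Q x (g x) + (- (\<gamma> ^ Suc n * C))" by (simp add: greedy)
  also have "\<dots> = row_dot (p x (g x)) (\<lambda>y. (r x (g x) y + \<gamma> * vmax Q y) + (- (\<gamma> ^ Suc n * C)))"
    unfolding row_dot_add_const by (metis assms(2) bellman_def)
  also have "\<dots> \<le> row_dot (p x (g x)) (\<lambda>y. r x (g x) y + \<gamma> * ?R y)"
  proof (rule row_dot_mono)
    fix y
    have "\<gamma> * (vmax Q y - \<gamma> ^ n * C) \<le> \<gamma> * ?R y"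
      using Suc assms(1) by (intro mult_left_mono)
    then show "(r x (g x) y + \<gamma> * vmax Q y) + (- (\<gamma> ^ Suc n * C)) \<le> r x (g x) y + \<gamma> * ?R y"
      by (simp add: algebra_simps)
  qed
  also have "\<dots> = policy_return \<gamma> p r (\<lambda>h x. return_pmf (g x)) (Suc n) h x"
    using row_dot_return[of "g x"] unfolding row_dot_def[of "return_pmf _"] policy_return.simps by simp
  finally show ?case .
qed

text \<open>Policies are compared with the fixed point of the Bellman operator: no policy exceeds it in
  the limit and the greedy one attains it, so it is the supremum \<open>Qstar\<close>.\<close>

theorem Qstar_bellman:
  fixes p :: "('x::finite, 'u::finite) kernel"
  assumes "0 \<le> \<gamma>" "\<gamma> < 1"
  shows "bellman \<gamma> p r (Qstar \<gamma> p r) = Qstar \<gamma> p r"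
proof -
  obtain Q where Q: "bellman \<gamma> p r Q = Q"
    using bellman_fixed_point[OF assms] .
  obtain C where C: "\<And>x. \<bar>vmax Q x\<bar> \<le> C"
    using finite_family_bounded by blast
  have decay: "(\<lambda>n. \<gamma> ^ n * C) \<longlonglongrightarrow> 0"
    using assms by (intro tendsto_mult_left_zero LIMSEQ_realpow_zero)
  have Q_eq: "Q x u = row_dot (p x u) (\<lambda>y. r x u y + \<gamma> * vmax Q y)" for x u
    by (metis Q bellman_def)
  have upper: "policy_q \<gamma> p r \<pi> x u \<le> Q x u" for \<pi> x u
  proof (rule LIMSEQ_le[OF policy_q_lim[OF assms]])
    show "(\<lambda>n. row_dot (p x u) (\<lambda>y. r x u y + \<gamma> * (vmax Q y + \<gamma> ^ n * C))) \<longlonglongrightarrow> Q x u"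
      unfolding Q_eq[of x u] row_dot_def by (rule tendsto_eq_intros decay refl | simp)+
    show "\<exists>N. \<forall>n\<ge>N. row_dot (p x u) (\<lambda>y. r x u y + \<gamma> * policy_return \<gamma> p r \<pi> n [(x, u)] y)
        \<le> row_dot (p x u) (\<lambda>y. r x u y + \<gamma> * (vmax Q y + \<gamma> ^ n * C))"
      using policy_return_upper[OF assms(1) Q C] assms(1)
      by (intro exI[of _ 0] allI impI row_dot_mono add_left_mono mult_left_mono)
  qed
  obtain g where g: "\<And>x. Q x (g x) = vmax Q x"
    using vmax_attained by metis
  have lower: "Q x u \<le> policy_q \<gamma> p r (\<lambda>h x. return_pmf (g x)) x u" for x u
  proof (rule LIMSEQ_le[OF _ policy_q_lim[OF assms]])
    show "(\<lambda>n. row_dot (p x u) (\<lambda>y. r x u y + \<gamma> * (vmax Q y - \<gamma> ^ n * C))) \<longlonglongrightarrow> Q x u"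
      unfolding Q_eq[of x u] row_dot_def by (rule tendsto_eq_intros decay refl | simp)+
    show "\<exists>N. \<forall>n\<ge>N. row_dot (p x u) (\<lambda>y. r x u y + \<gamma> * (vmax Q y - \<gamma> ^ n * C)) \<le>
        row_dot (p x u) (\<lambda>y. r x u y + \<gamma> * policy_return \<gamma> p r (\<lambda>h x. return_pmf (g x)) n [(x, u)] y)"
      using policy_return_greedy[OF assms(1) Q C g] assms(1)
      by (intro exI[of _ 0] allI impI row_dot_mono add_left_mono mult_left_mono)
  qed
  have "Qstar \<gamma> p r x u = Q x u" for x u
    unfolding Qstar_def
  proof (rule cSup_eq_maximum)
    show "Q x u \<in> range (\<lambda>\<pi>. policy_q \<gamma> p r \<pi> x u)"
      using upper lower by (intro range_eqI antisym)
  qed (use upper in auto)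
  then have "Qstar \<gamma> p r = Q" by blast
  then show ?thesis using Q by simp
qed

subsection \<open>A weak law of large numbers for the detection phase\<close>

text \<open>Orthogonality of increments: vanishing integrals over the events of \<open>F t\<close>
  mean that \<open>Z t\<close> has conditional expectation zero, so its product with the
  \<open>F t\<close>-measurable partial sum integrates to zero. Each step therefore adds only a
  square, at most \<open>C\<^sup>2\<close>.\<close>

lemma (in prob_space) martingale_difference_second_moment:
  fixes Z :: "nat \<Rightarrow> 'a \<Rightarrow> real"
  assumes filt: "filtration (space M) F" and sub: "\<And>t. subalgebra M (F t)"
    and meas: "\<And>s. Z s \<in> borel_measurable (F (Suc s))"
    and bound: "\<And>s \<omega>. \<bar>Z s \<omega>\<bar> \<le> C"
    and centred: "\<And>s A. A \<in> sets (F s) \<Longrightarrow> (\<integral>\<omega>. indicator A \<omega> * Z s \<omega> \<partial>M) = 0"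
  shows "expectation (\<lambda>\<omega>. (\<Sum>s<t. Z s \<omega>)\<^sup>2) \<le> real t * C\<^sup>2"
proof (induction t)
  case 0
  then show ?case by simp
next
  case (Suc t)
  let ?S = "\<lambda>\<omega>. \<Sum>s<t. Z s \<omega>"
  interpret sub: finite_measure_subalgebra M "F t"
    by unfold_locales (rule sub)
  have measM[measurable]: "Z s \<in> borel_measurable M" for s
    using measurable_from_subalg[OF sub meas] .
  have S_F: "?S \<in> borel_measurable (F t)"
  proof (rule borel_measurable_sum)
    fix s assume "s \<in> {..<t}"
    then have "subalgebra (F t) (F (Suc s))"
      using filtration.sets_F_mono[OF filt, of "Suc s" t] filtration.space_F[OF filt]
      by (auto simp: subalgebra_def)
    then show "Z s \<in> borel_measurable (F t)"
      by (rule measurable_from_subalg[OF _ meas])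
  qed
  have C0: "0 \<le> C" using bound[of 0 undefined] by linarith
  have S_bound: "\<bar>?S \<omega>\<bar> \<le> real t * C" for \<omega>
    using sum_norm_bound[of "{..<t}" "\<lambda>s. Z s \<omega>" C] bound by simp
  have int: "integrable M (\<lambda>\<omega>. ?S \<omega> * Z t \<omega>)" "integrable M (\<lambda>\<omega>. (?S \<omega>)\<^sup>2)"
    "integrable M (\<lambda>\<omega>. (Z t \<omega>)\<^sup>2)" "integrable M (Z t)"
  proof -
    show "integrable M (\<lambda>\<omega>. ?S \<omega> * Z t \<omega>)"
      by (rule integrable_const_bound[where B="real t * C * C"])
         (use S_bound bound C0 in \<open>auto simp: abs_mult intro!: mult_mono\<close>)
    show "integrable M (\<lambda>\<omega>. (?S \<omega>)\<^sup>2)"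
      by (rule integrable_const_bound[where B="(real t * C)\<^sup>2"])
         (use S_bound C0 in \<open>auto intro!: AE_I2 simp flip: abs_le_square_iff\<close>)
    show "integrable M (\<lambda>\<omega>. (Z t \<omega>)\<^sup>2)"
      by (rule integrable_const_bound[where B="C\<^sup>2"])
         (use bound C0 in \<open>auto intro!: AE_I2 simp flip: abs_le_square_iff\<close>)
    show "integrable M (Z t)"
      by (rule integrable_const_bound[where B="C"]) (use bound in auto)
  qed
  have "AE \<omega> in M. real_cond_exp M (F t) (Z t) \<omega> = 0"
    using centred int(4)
    by (intro sub.real_cond_exp_charact) (auto simp: set_lebesgue_integral_def)
  then have "expectation (\<lambda>\<omega>. ?S \<omega> * real_cond_exp M (F t) (Z t) \<omega>) = 0"
    by (intro integral_eq_zero_AE) auto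
  then have cross: "expectation (\<lambda>\<omega>. ?S \<omega> * Z t \<omega>) = 0"
    using sub.real_cond_exp_intg(2)[OF int(1) S_F measM] by simp
  have "expectation (\<lambda>\<omega>. (\<Sum>s<Suc t. Z s \<omega>)\<^sup>2)
      = expectation (\<lambda>\<omega>. (?S \<omega>)\<^sup>2 + 2 * (?S \<omega> * Z t \<omega>) + (Z t \<omega>)\<^sup>2)"
    by (simp add: power2_sum algebra_simps)
  also have "\<dots> = expectation (\<lambda>\<omega>. (?S \<omega>)\<^sup>2) + expectation (\<lambda>\<omega>. (Z t \<omega>)\<^sup>2)"
    using int cross by simp
  also have "expectation (\<lambda>\<omega>. (Z t \<omega>)\<^sup>2) \<le> C\<^sup>2"
    using int(3) bound C0 by (intro integral_le_const) (auto intro!: AE_I2 simp flip: abs_le_square_iff)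
  finally show ?case using Suc by (simp add: algebra_simps)
qed

text \<open>Chebyshev: the second moment grows at most linearly in \<open>t\<close>, the squared
  threshold quadratically.\<close>

lemma (in prob_space) martingale_difference_weak_law:
  fixes Z :: "nat \<Rightarrow> 'a \<Rightarrow> real"
  assumes filt: "filtration (space M) F" and sub: "\<And>t. subalgebra M (F t)"
    and meas: "\<And>s. Z s \<in> borel_measurable (F (Suc s))"
    and bound: "\<And>s \<omega>. \<bar>Z s \<omega>\<bar> \<le> C"
    and centred: "\<And>s A. A \<in> sets (F s) \<Longrightarrow> (\<integral>\<omega>. indicator A \<omega> * Z s \<omega> \<partial>M) = 0"
    and "\<delta> > 0"
  shows "(\<lambda>t. \<P>(\<omega> in M. \<delta> * real t \<le> \<bar>\<Sum>s<t. Z s \<omega>\<bar>)) \<longlonglongrightarrow> 0"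
proof (rule tendsto_sandwich[where f="\<lambda>_. 0" and h="\<lambda>t. C\<^sup>2 / \<delta>\<^sup>2 * inverse (real t)"])
  have measM[measurable]: "Z s \<in> borel_measurable M" for s
    using measurable_from_subalg[OF sub meas] .
  have C0: "0 \<le> C" using bound[of 0 undefined] by linarith
  show "\<forall>\<^sub>F t in sequentially.
      \<P>(\<omega> in M. \<delta> * real t \<le> \<bar>\<Sum>s<t. Z s \<omega>\<bar>) \<le> C\<^sup>2 / \<delta>\<^sup>2 * inverse (real t)"
  proof (intro eventually_sequentiallyI[of 1])
    fix t :: nat assume t: "1 \<le> t"
    have S_bound: "\<bar>\<Sum>s<t. Z s \<omega>\<bar> \<le> real t * C" for \<omega>
      using sum_norm_bound[of "{..<t}" "\<lambda>s. Z s \<omega>" C] bound by simp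
    have "integrable M (\<lambda>\<omega>. (\<Sum>s<t. Z s \<omega>)\<^sup>2)"
      by (rule integrable_const_bound[where B="(real t * C)\<^sup>2"])
         (use S_bound C0 in \<open>auto intro!: AE_I2 simp flip: abs_le_square_iff\<close>)
    then have "\<P>(\<omega> in M. \<delta> * real t \<le> \<bar>\<Sum>s<t. Z s \<omega>\<bar>)
        \<le> expectation (\<lambda>\<omega>. (\<Sum>s<t. Z s \<omega>)\<^sup>2) / (\<delta> * real t)\<^sup>2"
      using t \<open>\<delta> > 0\<close> by (intro second_moment_method) auto
    also have "\<dots> \<le> real t * C\<^sup>2 / (\<delta> * real t)\<^sup>2"
      using martingale_difference_second_moment[OF filt sub meas bound centred]
      by (intro divide_right_mono) auto
    also have "\<dots> = C\<^sup>2 / \<delta>\<^sup>2 * inverse (real t)"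
      using t by (simp add: field_simps power2_eq_square)
    finally show "\<P>(\<omega> in M. \<delta> * real t \<le> \<bar>\<Sum>s<t. Z s \<omega>\<bar>) \<le> C\<^sup>2 / \<delta>\<^sup>2 * inverse (real t)" .
  qed
  show "(\<lambda>t. C\<^sup>2 / \<delta>\<^sup>2 * inverse (real t)) \<longlonglongrightarrow> 0"
    by (intro tendsto_mult_right_zero lim_inverse_n)
qed auto

text \<open>The hypothesis \<open>law\<close> says that the image under \<open>W\<close> of
  \<open>M\<close> restricted to \<open>E\<close> is \<open>c\<close> times \<nu>. Equality of these
  two measures carries the rule from sets to integrands; in use, \<open>c\<close> is the probability
  of \<open>E\<close>.\<close>

lemma (in prob_space) integral_product_law:
  assumes [measurable]: "E \<in> sets M" "W \<in> borel_measurable M"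
    and \<nu>: "prob_space \<nu>" "sets \<nu> = sets borel" and c: "0 \<le> c"
    and law: "\<And>B. B \<in> sets borel \<Longrightarrow> prob {\<omega>\<in>E. W \<omega> \<in> B} = c * measure \<nu> B"
    and f: "f \<in> borel_measurable borel"
  shows "(\<integral>\<omega>. indicator E \<omega> * f (W \<omega>) \<partial>M) = c * (LINT w|\<nu>. f w :: real)"
    and "integrable \<nu> f \<Longrightarrow> integrable M (\<lambda>\<omega>. indicator E \<omega> * f (W \<omega>))"
proof -
  interpret \<nu>: prob_space \<nu> by (rule \<nu>)
  let ?D = "density M (\<lambda>\<omega>. ennreal (indicator E \<omega>))"
  have f': "f \<in> borel_measurable \<nu>" using f \<nu>(2) by (simp cong: measurable_cong_sets)
  have eq: "distr ?D borel W = density \<nu> (\<lambda>_. ennreal c)"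
  proof (rule measure_eqI)
    fix B assume "B \<in> sets (distr ?D borel W)"
    then have B[measurable]: "B \<in> sets borel" by simp
    have "emeasure (distr ?D borel W) B = emeasure ?D (W -` B \<inter> space M)"
      by (subst emeasure_distr) auto
    also have "\<dots> = emeasure M (E \<inter> (W -` B \<inter> space M))"
      unfolding ennreal_indicator by (subst emeasure_restricted) auto
    also have "E \<inter> (W -` B \<inter> space M) = {\<omega>\<in>E. W \<omega> \<in> B}"
      using sets.sets_into_space[OF \<open>E \<in> sets M\<close>] by auto
    also have "emeasure M \<dots> = ennreal (c * measure \<nu> B)"
      by (simp add: emeasure_eq_measure law B)
    also have "\<dots> = emeasure (density \<nu> (\<lambda>_. ennreal c)) B"
      using B \<nu>(2) c by (subst emeasure_density_const) (auto simp: \<nu>.emeasure_eq_measure ennreal_mult)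
    finally show "emeasure (distr ?D borel W) B = emeasure (density \<nu> (\<lambda>_. ennreal c)) B" .
  qed (simp add: \<nu>(2))
  have "(\<integral>\<omega>. indicator E \<omega> * f (W \<omega>) \<partial>M) = (\<integral>\<omega>. f (W \<omega>) \<partial>?D)"
    using f by (subst integral_density) auto
  also have "\<dots> = (\<integral>w. f w \<partial>distr ?D borel W)"
    using f by (subst integral_distr) auto
  also have "\<dots> = c * (LINT w|\<nu>. f w)"
    unfolding eq using f' c by (subst integral_density) auto
  finally show "(\<integral>\<omega>. indicator E \<omega> * f (W \<omega>) \<partial>M) = c * (LINT w|\<nu>. f w)" .
  assume "integrable \<nu> f"
  then have "integrable (density \<nu> (\<lambda>_. ennreal c)) f"
    using f' c by (subst integrable_density) auto
  then have "integrable (distr ?D borel W) f" by (simp only: eq)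
  then have "integrable ?D (\<lambda>\<omega>. f (W \<omega>))"
    using f by (subst (asm) integrable_distr_eq) auto
  then show "integrable M (\<lambda>\<omega>. indicator E \<omega> * f (W \<omega>))"
    using f by (subst (asm) integrable_density) auto
qed

text \<open>Dominated convergence with \<open>\<bar>w\<bar>\<close> as the bound: for each
  \<open>w\<close> the integrand vanishes once \<open>n\<close> passes its absolute value.\<close>

lemma truncated_first_moment_tendsto_0:
  assumes "integrable \<nu> (\<lambda>w. w)" "sets \<nu> = sets borel"
  shows "(\<lambda>n. LINT w|\<nu>. \<bar>w\<bar> * of_bool (\<bar>w\<bar> > real n)) \<longlonglongrightarrow> 0"
proof -
  have m[measurable_cong]: "sets \<nu> = sets borel" by fact
  have "(\<lambda>n. LINT w|\<nu>. \<bar>w\<bar> * of_bool (\<bar>w\<bar> > real n)) \<longlonglongrightarrow> (LINT w|\<nu>. (0::real))"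
  proof (rule integral_dominated_convergence[where w="\<lambda>w. \<bar>w\<bar>"])
    show "integrable \<nu> (\<lambda>w. \<bar>w\<bar>)" using assms(1) by simp
    show "AE w in \<nu>. (\<lambda>n. \<bar>w\<bar> * of_bool (\<bar>w\<bar> > real n)) \<longlonglongrightarrow> 0"
    proof (rule AE_I2)
      fix w :: real
      have "\<forall>\<^sub>F n in sequentially. \<bar>w\<bar> * of_bool (\<bar>w\<bar> > real n) = 0"
        by (rule eventually_sequentiallyI[of "nat \<lceil>\<bar>w\<bar>\<rceil>"]) (auto simp: not_less nat_le_iff ceiling_le_iff)
      then show "(\<lambda>n. \<bar>w\<bar> * of_bool (\<bar>w\<bar> > real n)) \<longlonglongrightarrow> 0"
        by (rule tendsto_eventually)
    qed
    show "AE w in \<nu>. norm (\<bar>w\<bar> * of_bool (\<bar>w\<bar> > real n)) \<le> \<bar>w\<bar>" for n by simp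
  qed (auto simp: of_bool_def)
  then show ?thesis by simp
qed

section \<open>Limit theorems for the controlled process, for an arbitrary kernel shown to the
  agent\<close>

locale detection_phase =
  fixes K :: "('x::finite, 'u::finite) kernel" and \<nu> :: "real measure" and M :: "'w measure"
    and F X U W
  assumes process: "controlled_process K \<nu> M F X U W" and noise: "zero_mean_noise \<nu>"
begin

sublocale prob_space M
  using process by (simp add: controlled_process_def)

sublocale \<nu>: prob_space \<nu>
  using noise by (simp add: zero_mean_noise_def)

lemma sets_\<nu>[measurable_cong]: "sets \<nu> = sets borel"
  using noise by (simp add: zero_mean_noise_def)

lemma integrable_noise: "integrable \<nu> (\<lambda>w. w)" and mean_noise: "(LINT w|\<nu>. w) = 0"
  using noise by (simp_all add: zero_mean_noise_def)

lemma filt: "filtration (space M) F" and sub: "subalgebra M (F t)"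
  using process by (auto simp: controlled_process_def)

lemma sub_mono: "s \<le> t \<Longrightarrow> subalgebra (F t) (F s)"
  using filtration.sets_F_mono[OF filt, of s t] filtration.space_F[OF filt]
  by (auto simp: subalgebra_def)

lemma measurable_F:
  "X t \<in> F t \<rightarrow>\<^sub>M count_space UNIV" "U t \<in> F t \<rightarrow>\<^sub>M count_space UNIV" "W t \<in> F (Suc t) \<rightarrow>\<^sub>M borel"
  using process by (auto simp: controlled_process_def)

lemma measurable_F_Suc[measurable]:
  "X t \<in> F (Suc t) \<rightarrow>\<^sub>M count_space UNIV" "U t \<in> F (Suc t) \<rightarrow>\<^sub>M count_space UNIV"
  "X (Suc t) \<in> F (Suc t) \<rightarrow>\<^sub>M count_space UNIV" "W t \<in> F (Suc t) \<rightarrow>\<^sub>M borel"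
  using measurable_from_subalg[OF sub_mono[of t "Suc t"] measurable_F(1)]
    measurable_from_subalg[OF sub_mono[of t "Suc t"] measurable_F(2)] measurable_F by auto

lemma measurable_M[measurable]:
  "X t \<in> M \<rightarrow>\<^sub>M count_space UNIV" "U t \<in> M \<rightarrow>\<^sub>M count_space UNIV" "W t \<in> borel_measurable M"
  using measurable_from_subalg[OF sub] measurable_F by blast+

abbreviation visiting :: "'x \<Rightarrow> 'u \<Rightarrow> nat \<Rightarrow> 'w \<Rightarrow> bool" where
  "visiting i j t \<omega> \<equiv> X t \<omega> = i \<and> U t \<omega> = j"

lemma sets_F_M: "A \<in> sets (F t) \<Longrightarrow> A \<in> sets M"
  using sub by (auto simp: subalgebra_def)

lemma transition_law:
  assumes "A \<in> sets (F t)" "B \<in> sets borel"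
  shows "prob {\<omega>\<in>A. X t \<omega> = i \<and> U t \<omega> = j \<and> X (Suc t) \<omega> = y \<and> W t \<omega> \<in> B} =
    prob {\<omega>\<in>A. visiting i j t \<omega>} * pmf (K i j) y * measure \<nu> B"
  using process assms unfolding controlled_process_def by blast

lemma noise_law:
  assumes A: "A \<in> sets (F t)" and B: "B \<in> sets borel"
  shows "prob {\<omega>\<in>{\<omega>\<in>A. visiting i j t \<omega>}. W t \<omega> \<in> B} = prob {\<omega>\<in>A. visiting i j t \<omega>} * measure \<nu> B"
proof -
  note [measurable] = sets_F_M[OF A] B
  have "{\<omega>\<in>{\<omega>\<in>A. visiting i j t \<omega>}. W t \<omega> \<in> B}
      = (\<Union>y\<in>UNIV. {\<omega>\<in>A. X t \<omega> = i \<and> U t \<omega> = j \<and> X (Suc t) \<omega> = y \<and> W t \<omega> \<in> B})"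
    by auto
  also have "prob \<dots> = (\<Sum>y\<in>UNIV. prob {\<omega>\<in>A. X t \<omega> = i \<and> U t \<omega> = j \<and> X (Suc t) \<omega> = y \<and> W t \<omega> \<in> B})"
  proof (rule finite_measure_finite_Union)
    have "{\<omega>\<in>A. X t \<omega> = i \<and> U t \<omega> = j \<and> X (Suc t) \<omega> = y \<and> W t \<omega> \<in> B} \<in> sets M" for y
      by measurable
    then show "(\<lambda>y. {\<omega>\<in>A. X t \<omega> = i \<and> U t \<omega> = j \<and> X (Suc t) \<omega> = y \<and> W t \<omega> \<in> B}) ` UNIV \<subseteq> sets M"
      by blast
  qed (auto simp: disjoint_family_on_def)
  also have "\<dots> = prob {\<omega>\<in>A. visiting i j t \<omega>} * measure \<nu> B"
    by (simp add: transition_law[OF A B] sum_pmf_eq_1 flip: sum_distrib_left sum_distrib_right)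
  finally show ?thesis .
qed

lemma noise_integral:
  assumes A: "A \<in> sets (F t)" and g: "g \<in> borel_measurable borel"
  shows "(\<integral>\<omega>. indicator A \<omega> * (of_bool (visiting i j t \<omega>) * g (W t \<omega>)) \<partial>M)
      = prob {\<omega>\<in>A. visiting i j t \<omega>} * (LINT w|\<nu>. g w :: real)"
    and "integrable \<nu> g \<Longrightarrow> integrable M (\<lambda>\<omega>. indicator A \<omega> * (of_bool (visiting i j t \<omega>) * g (W t \<omega>)))"
proof -
  note [measurable] = sets_F_M[OF A]
  have E: "{\<omega>\<in>A. visiting i j t \<omega>} \<in> sets M" by measurable
  have eq: "indicator A \<omega> * (of_bool (visiting i j t \<omega>) * g (W t \<omega>)) = indicator {\<omega>\<in>A. visiting i j t \<omega>} \<omega> * g (W t \<omega>)" for \<omega>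
    by (auto simp: indicator_def)
  note * = integral_product_law[OF E measurable_M(3) \<nu>.prob_space_axioms sets_\<nu> measure_nonneg noise_law[OF A] g]
  show "(\<integral>\<omega>. indicator A \<omega> * (of_bool (visiting i j t \<omega>) * g (W t \<omega>)) \<partial>M)
      = prob {\<omega>\<in>A. visiting i j t \<omega>} * (LINT w|\<nu>. g w :: real)"
    unfolding eq by (rule *)
  show "integrable M (\<lambda>\<omega>. indicator A \<omega> * (of_bool (visiting i j t \<omega>) * g (W t \<omega>)))" if "integrable \<nu> g"
    unfolding eq by (rule *(2)) (use that in auto)
qed

text \<open>Given the past and a visit, the next state has law \<open>K i j\<close>; indicators of
  single next states are centred one by one, so that no reward and no estimate enters.\<close>

lemma transition_centred:
  assumes A: "A \<in> sets (F t)"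
  shows "(\<integral>\<omega>. indicator A \<omega> * (of_bool (visiting i j t \<omega>) * (of_bool (X (Suc t) \<omega> = y) - pmf (K i j) y)) \<partial>M) = 0"
proof -
  note [measurable] = sets_F_M[OF A]
  have E: "{\<omega>\<in>A. visiting i j t \<omega>} \<in> sets M" "{\<omega>\<in>A. visiting i j t \<omega> \<and> X (Suc t) \<omega> = y} \<in> sets M"
    by measurable
  have "(\<integral>\<omega>. indicator A \<omega> * (of_bool (visiting i j t \<omega>) * (of_bool (X (Suc t) \<omega> = y) - pmf (K i j) y)) \<partial>M)
     = (\<integral>\<omega>. indicator {\<omega>\<in>A. visiting i j t \<omega> \<and> X (Suc t) \<omega> = y} \<omega>
          - pmf (K i j) y * indicator {\<omega>\<in>A. visiting i j t \<omega>} \<omega> \<partial>M)"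
    by (intro Bochner_Integration.integral_cong) (auto simp: indicator_def)
  also have "\<dots> = prob {\<omega>\<in>A. visiting i j t \<omega> \<and> X (Suc t) \<omega> = y} - pmf (K i j) y * prob {\<omega>\<in>A. visiting i j t \<omega>}"
    using E by (subst Bochner_Integration.integral_diff) (auto simp: emeasure_eq_measure)
  also have "prob {\<omega>\<in>A. visiting i j t \<omega> \<and> X (Suc t) \<omega> = y} = prob {\<omega>\<in>A. visiting i j t \<omega>} * pmf (K i j) y"
    using transition_law[OF A, of UNIV i j y] \<nu>.prob_space sets_eq_imp_space_eq[OF sets_\<nu>]
    by (simp add: conj_assoc)
  finally show ?thesis by simp
qed

lemma transition_weak_law:
  assumes "\<delta> > 0"
  shows "(\<lambda>t. \<P>(\<omega> in M. \<delta> * real t \<le>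
    \<bar>\<Sum>s<t. of_bool (visiting i j s \<omega>) * (of_bool (X (Suc s) \<omega> = y) - pmf (K i j) y)\<bar>)) \<longlonglongrightarrow> 0"
proof (rule martingale_difference_weak_law[OF filt sub _ _ transition_centred assms])
  show "\<bar>of_bool (visiting i j s \<omega>) * (of_bool (X (Suc s) \<omega> = y) - pmf (K i j) y)\<bar> \<le> 1" for s \<omega>
    using pmf_le_1[of "K i j" y] by auto
qed (auto simp: of_bool_def)

text \<open>The order of choices matters: the truncation level depends on \<open>e\<close> and
  \<open>\<delta>\<close> alone and is fixed before \<open>t\<close> grows. The remainder then costs
  at most \<open>e / 2\<close> at every positive time, while the truncated part is a bounded
  martingale difference and dies out with \<open>t\<close>.\<close>

lemma noise_weak_law:
  assumes "\<delta> > 0"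
  shows "(\<lambda>t. \<P>(\<omega> in M. \<delta> * real t \<le> \<bar>\<Sum>s<t. of_bool (visiting i j s \<omega>) * W s \<omega>\<bar>)) \<longlonglongrightarrow> 0"
proof (rule LIMSEQ_I)
  fix e :: real assume "0 < e"
  define \<tau> where "\<tau> n = (LINT w|\<nu>. \<bar>w\<bar> * of_bool (\<bar>w\<bar> > real n))" for n
  \<comment> \<open>Origin of the 8: the remainder has mean at most \<open>2 * \<tau> n\<close> per
    time step, Markov at level \<open>\<delta> / 2 * real t\<close> turns this into
    \<open>4 * \<tau> n / \<delta>\<close>, and \<open>e / 2\<close> is allotted to it.\<close>
  have "\<forall>\<^sub>F n in sequentially. \<tau> n < e * \<delta> / 8"
    using truncated_first_moment_tendsto_0[OF integrable_noise sets_\<nu>] \<open>0 < e\<close> \<open>0 < \<delta>\<close>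
    unfolding \<tau>_def by (intro order_tendstoD) auto
  then obtain n where n: "\<tau> n < e * \<delta> / 8"
    by (auto simp: eventually_sequentially)
  \<comment> \<open>The noise has no second moment: \<open>g\<close> is its recentred truncation, handled in mean square,
    and the remainder is handled in mean.\<close>
  define m where "m = (LINT w|\<nu>. w * of_bool (\<bar>w\<bar> \<le> real n))"
  define g where "g w = w * of_bool (\<bar>w\<bar> \<le> real n) - m" for w :: real
  have [measurable]: "g \<in> borel_measurable borel"
    unfolding g_def of_bool_def by measurable
  have int: "integrable \<nu> (\<lambda>w. w * of_bool (\<bar>w\<bar> \<le> real n))" "integrable \<nu> (\<lambda>w. w * of_bool (\<bar>w\<bar> > real n))"
    by (auto intro!: Bochner_Integration.integrable_bound[OF integrable_noise] simp: of_bool_def)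
  have int_abs: "integrable \<nu> (\<lambda>w. \<bar>w\<bar> * of_bool (\<bar>w\<bar> > real n))"
    using integrable_abs[OF int(2)] by (simp add: abs_mult)
  have g_mean: "(LINT w|\<nu>. g w) = 0"
    unfolding g_def using int by (simp add: m_def \<nu>.prob_space)
  have m_bound: "\<bar>m\<bar> \<le> real n"
  proof -
    have "\<bar>m\<bar> \<le> (LINT w|\<nu>. \<bar>w * of_bool (\<bar>w\<bar> \<le> real n)\<bar>)"
      unfolding m_def by (rule integral_abs_bound)
    also have "\<dots> \<le> real n"
      using integrable_abs[OF int(1)] by (intro \<nu>.integral_le_const) auto
    finally show ?thesis .
  qed
  have g_bound: "\<bar>g w\<bar> \<le> 2 * real n" for w
    using m_bound by (auto simp: g_def)
  \<comment> \<open>As the noise has mean zero, the mean of its truncation is minus the mean of the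
    part cut off.\<close>
  have m_tail: "\<bar>m\<bar> \<le> \<tau> n"
  proof -
    have "(LINT w|\<nu>. w) = (LINT w|\<nu>. w * of_bool (\<bar>w\<bar> \<le> real n) + w * of_bool (\<bar>w\<bar> > real n))"
      by (intro Bochner_Integration.integral_cong) auto
    then have "m + (LINT w|\<nu>. w * of_bool (\<bar>w\<bar> > real n)) = (LINT w|\<nu>. w)"
      using int by (simp add: m_def)
    then have "\<bar>m\<bar> = \<bar>LINT w|\<nu>. w * of_bool (\<bar>w\<bar> > real n)\<bar>" by (simp add: mean_noise)
    also have "\<dots> \<le> (LINT w|\<nu>. \<bar>w * of_bool (\<bar>w\<bar> > real n)\<bar>)"
      by (rule integral_abs_bound)
    finally show ?thesis by (simp add: abs_mult \<tau>_def)
  qed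
  have h_int: "integrable \<nu> (\<lambda>w. \<bar>w - g w\<bar>)"
    by (auto simp: g_def intro!: Bochner_Integration.integrable_diff int integrable_noise)
  have "(LINT w|\<nu>. \<bar>w - g w\<bar>) \<le> (LINT w|\<nu>. \<bar>w\<bar> * of_bool (\<bar>w\<bar> > real n) + \<bar>m\<bar>)"
    using h_int int_abs by (intro integral_mono) (auto simp: g_def)
  also have "\<dots> = \<tau> n + \<bar>m\<bar>"
    using int_abs by (simp add: \<tau>_def \<nu>.prob_space)
  finally have h_mean: "(LINT w|\<nu>. \<bar>w - g w\<bar>) \<le> 2 * \<tau> n" using m_tail by simp
  define T where "T t \<omega> = (\<Sum>s<t. of_bool (visiting i j s \<omega>) * g (W s \<omega>))" for t \<omega>
  define R where "R t \<omega> = (\<Sum>s<t. of_bool (visiting i j s \<omega>) * \<bar>W s \<omega> - g (W s \<omega>)\<bar>)" for t \<omega>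
  have [measurable]: "T t \<in> borel_measurable M" "R t \<in> borel_measurable M" for t
    unfolding T_def R_def of_bool_def by measurable
  have "(\<lambda>t. \<P>(\<omega> in M. \<delta> / 2 * real t \<le> \<bar>T t \<omega>\<bar>)) \<longlonglongrightarrow> 0"
    unfolding T_def
  proof (rule martingale_difference_weak_law[OF filt sub])
    show "(\<lambda>\<omega>. of_bool (visiting i j s \<omega>) * g (W s \<omega>)) \<in> borel_measurable (F (Suc s))" for s
      unfolding of_bool_def by measurable
    show "\<bar>of_bool (visiting i j s \<omega>) * g (W s \<omega>)\<bar> \<le> 2 * real n" for s \<omega>
      using g_bound by auto
    show "(\<integral>\<omega>. indicator A \<omega> * (of_bool (visiting i j s \<omega>) * g (W s \<omega>)) \<partial>M) = 0" if "A \<in> sets (F s)" for s A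
      using noise_integral(1)[OF that, of g] g_mean by simp
    show "0 < \<delta> / 2" using assms by simp
  qed
  then have "\<forall>\<^sub>F t in sequentially. \<P>(\<omega> in M. \<delta> / 2 * real t \<le> \<bar>T t \<omega>\<bar>) < e / 2"
    using \<open>0 < e\<close> by (intro order_tendstoD) auto
  then obtain t0 where t0: "\<And>t. t0 \<le> t \<Longrightarrow> \<P>(\<omega> in M. \<delta> / 2 * real t \<le> \<bar>T t \<omega>\<bar>) < e / 2"
    by (auto simp: eventually_sequentially)
  have tail: "\<P>(\<omega> in M. \<delta> / 2 * real t \<le> R t \<omega>) \<le> 4 * \<tau> n / \<delta>" if t: "1 \<le> t" for t
  proof -
    have top: "space M \<in> sets (F s)" for s
      by (metis sets.top sub subalgebra_def)
    have tail_term: "integrable M (\<lambda>\<omega>. of_bool (visiting i j s \<omega>) * \<bar>W s \<omega> - g (W s \<omega>)\<bar>)"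
      "expectation (\<lambda>\<omega>. of_bool (visiting i j s \<omega>) * \<bar>W s \<omega> - g (W s \<omega>)\<bar>) \<le> 2 * \<tau> n" for s
    proof -
      have i: "integrable M (\<lambda>\<omega>. indicator (space M) \<omega> * (of_bool (visiting i j s \<omega>) * \<bar>W s \<omega> - g (W s \<omega>)\<bar>))"
        using noise_integral(2)[OF top _ h_int] by simp
      then show "integrable M (\<lambda>\<omega>. of_bool (visiting i j s \<omega>) * \<bar>W s \<omega> - g (W s \<omega>)\<bar>)"
        by (rule Bochner_Integration.integrable_cong[THEN iffD1, rotated 2]) auto
      have "expectation (\<lambda>\<omega>. of_bool (visiting i j s \<omega>) * \<bar>W s \<omega> - g (W s \<omega>)\<bar>)
        = expectation (\<lambda>\<omega>. indicator (space M) \<omega> * (of_bool (visiting i j s \<omega>) * \<bar>W s \<omega> - g (W s \<omega>)\<bar>))"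
        by (intro Bochner_Integration.integral_cong) auto
      also have "\<dots> = prob {\<omega>\<in>space M. visiting i j s \<omega>} * (LINT w|\<nu>. \<bar>w - g w\<bar>)"
        by (rule noise_integral(1)[OF top]) measurable
      also have "\<dots> \<le> 1 * (LINT w|\<nu>. \<bar>w - g w\<bar>)"
        by (intro mult_right_mono integral_nonneg) auto
      finally show "expectation (\<lambda>\<omega>. of_bool (visiting i j s \<omega>) * \<bar>W s \<omega> - g (W s \<omega>)\<bar>) \<le> 2 * \<tau> n"
        using h_mean by simp
    qed
    have "integrable M (R t)"
      unfolding R_def by (intro Bochner_Integration.integrable_sum tail_term(1))
    moreover have "AE \<omega> in M. 0 \<le> R t \<omega>"
      unfolding R_def by (intro AE_I2 sum_nonneg) simp
    ultimately have "\<P>(\<omega> in M. \<delta> / 2 * real t \<le> R t \<omega>) \<le> expectation (R t) / (\<delta> / 2 * real t)"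
      using t \<open>0 < \<delta>\<close> by (intro integral_Markov_inequality_measure[where A="{}"]) auto
    also have "expectation (R t) \<le> (\<Sum>s<t. 2 * \<tau> n)"
      unfolding R_def by (subst Bochner_Integration.integral_sum) (intro tail_term sum_mono)+
    finally show ?thesis
      using t \<open>0 < \<delta>\<close> by (simp add: divide_right_mono field_simps)
  qed
  show "\<exists>t0. \<forall>t\<ge>t0. norm (\<P>(\<omega> in M. \<delta> * real t \<le> \<bar>\<Sum>s<t. of_bool (visiting i j s \<omega>) * W s \<omega>\<bar>) - 0) < e"
  proof (intro exI[of _ "max 1 t0"] allI impI)
    fix t assume t: "max 1 t0 \<le> t"
    have "\<P>(\<omega> in M. \<delta> * real t \<le> \<bar>\<Sum>s<t. of_bool (visiting i j s \<omega>) * W s \<omega>\<bar>)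
      \<le> prob ({\<omega>\<in>space M. \<delta> / 2 * real t \<le> \<bar>T t \<omega>\<bar>} \<union> {\<omega>\<in>space M. \<delta> / 2 * real t \<le> R t \<omega>})"
    proof (rule finite_measure_mono)
      have split: "\<delta> / 2 * real t \<le> \<bar>T t \<omega>\<bar> \<or> \<delta> / 2 * real t \<le> R t \<omega>"
        if "\<delta> * real t \<le> \<bar>\<Sum>s<t. of_bool (visiting i j s \<omega>) * W s \<omega>\<bar>" for \<omega>
      proof -
        have "(\<Sum>s<t. of_bool (visiting i j s \<omega>) * W s \<omega>)
          = T t \<omega> + (\<Sum>s<t. of_bool (visiting i j s \<omega>) * (W s \<omega> - g (W s \<omega>)))"
          unfolding T_def sum.distrib[symmetric] by (intro sum.cong) (auto simp: algebra_simps)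
        moreover have "\<bar>\<Sum>s<t. of_bool (visiting i j s \<omega>) * (W s \<omega> - g (W s \<omega>))\<bar> \<le> R t \<omega>"
          unfolding R_def by (intro order_trans[OF sum_abs] sum_mono) (simp add: abs_mult)
        ultimately show ?thesis using that by (simp only: times_divide_eq_left) linarith
      qed
      show "{\<omega>\<in>space M. \<delta> * real t \<le> \<bar>\<Sum>s<t. of_bool (visiting i j s \<omega>) * W s \<omega>\<bar>} \<subseteq>
          {\<omega>\<in>space M. \<delta> / 2 * real t \<le> \<bar>T t \<omega>\<bar>} \<union> {\<omega>\<in>space M. \<delta> / 2 * real t \<le> R t \<omega>}"
        using split by blast
    qed measurable
    also have "\<dots> \<le> \<P>(\<omega> in M. \<delta> / 2 * real t \<le> \<bar>T t \<omega>\<bar>) + \<P>(\<omega> in M. \<delta> / 2 * real t \<le> R t \<omega>)"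
      by (rule measure_Un_le) measurable
    also have "\<dots> < e / 2 + e / 2"
    proof (rule add_less_le_mono)
      show "\<P>(\<omega> in M. \<delta> / 2 * real t \<le> \<bar>T t \<omega>\<bar>) < e / 2" using t0 t by simp
      have "4 * \<tau> n / \<delta> \<le> e / 2" using n \<open>0 < \<delta>\<close> by (simp add: field_simps)
      then show "\<P>(\<omega> in M. \<delta> / 2 * real t \<le> R t \<omega>) \<le> e / 2" using tail[of t] t by simp
    qed
    finally show "norm (\<P>(\<omega> in M. \<delta> * real t \<le> \<bar>\<Sum>s<t. of_bool (visiting i j s \<omega>) * W s \<omega>\<bar>) - 0) < e"
      by simp
  qed
qed

end

subsection \<open>Concentration of the sample deviations\<close>

text \<open>Replaces a path-dependent index set by a fixed time range with indicator weights, the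
  form in which the weak laws are stated.\<close>

lemma sum_visits:
  "(\<Sum>s\<in>visits x u t i j. f s) = (\<Sum>s<t. of_bool (x s = i \<and> u s = j) * (f s :: real))"
  by (simp add: visits_def lessThan_def Int_def)

lemma card_visits: "real (card (visits x u t i j)) = (\<Sum>s<t. of_bool (x s = i \<and> u s = j))"
  using sum_visits[of "\<lambda>_. 1"] by simp

text \<open>Pigeonhole: the visit counts add up to \<open>t\<close>, but if every pair were
  discarded they would add up to at most \<open>t / 2\<close>.\<close>

lemma retained_nonempty:
  fixes x :: "nat \<Rightarrow> 'x::finite" and u :: "nat \<Rightarrow> 'u::finite"
  assumes "t > 0"
  shows "retained x u t \<noteq> {}"
proof
  assume empty: "retained x u t = {}"
  let ?n = "real CARD('x) * real CARD('u)"
  have "(x s = fst k \<and> u s = snd k) = (k = (x s, u s))" for s k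
    by (auto simp: prod_eq_iff)
  then have "real t = (\<Sum>s<t. \<Sum>k\<in>(UNIV :: ('x \<times> 'u) set). of_bool (x s = fst k \<and> u s = snd k))"
    by simp
  also have "\<dots> = (\<Sum>k\<in>UNIV. real (card (visits x u t (fst k) (snd k))))"
    unfolding card_visits by (rule sum.swap)
  also have "\<dots> \<le> (\<Sum>k\<in>(UNIV :: ('x \<times> 'u) set). real t / (2 * ?n))"
    using empty by (intro sum_mono) (auto simp: retained_def not_less mult.assoc)
  also have "\<dots> = real t / 2"
    by (simp add: field_simps)
  finally show False using assms by simp
qed

lemma declares_breach_iff:
  assumes "t > 0"
  shows "declares_breach \<gamma> r thr Q x u w t \<longleftrightarrow>
    (\<exists>i j. (i, j) \<in> retained x u t \<and> \<bar>mean_deviation \<gamma> r Q x u w t i j\<bar> > thr)"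
  unfolding declares_breach_def using retained_nonempty[OF assms, of x u]
  by (subst Max_gr_iff) (auto simp: Bex_def)

text \<open>A pathwise statement, so \<open>Q\<close> may depend on the path. Multiplied by the
  number of visits, the difference is, up to sign, the noise sum plus the transition sums weighted
  by \<open>r + \<gamma> V\<close>; together they are at most
  \<open>\<eta> * t * (CARD('x) * C + 1)\<close>. Being retained bounds \<open>t\<close> by
  \<open>2 * CARD('x) * CARD('u)\<close> times the number of visits.\<close>

lemma mean_deviation_close:
  fixes x :: "nat \<Rightarrow> 'x::finite" and u :: "nat \<Rightarrow> 'u::finite"
  assumes t: "t > 0" and ret: "(i, j) \<in> retained x u t"
    and noise: "\<bar>\<Sum>s<t. of_bool (x s = i \<and> u s = j) * w s\<bar> \<le> \<eta> * real t"
    and trans: "\<And>y. \<bar>\<Sum>s<t. of_bool (x s = i \<and> u s = j) * (of_bool (x (Suc s) = y) - pmf (K i j) y)\<bar> \<le> \<eta> * real t"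
    and bound: "\<And>y. \<bar>r i j y + \<gamma> * vmax Q y\<bar> \<le> C"
  shows "\<bar>mean_deviation \<gamma> r Q x u w t i j - expected_deviation \<gamma> K r Q i j\<bar>
    \<le> 2 * real CARD('x) * real CARD('u) * \<eta> * (real CARD('x) * C + 1)"
proof -
  define n where "n = real (card (visits x u t i j))"
  define m where "m = 2 * real CARD('x) * real CARD('u)"
  define f where "f y = r i j y + \<gamma> * vmax Q y" for y
  define N where "N y = (\<Sum>s<t. of_bool (x s = i \<and> u s = j) * (of_bool (x (Suc s) = y) - pmf (K i j) y))" for y
  define S where "S = (\<Sum>s<t. of_bool (x s = i \<and> u s = j) * w s)"
  have m: "m > 0" by (simp add: m_def)
  have tn: "real t < m * n"
    using ret m by (simp add: retained_def n_def m_def field_simps)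
  then have n: "n > 0" using t m by (smt (verit) of_nat_0_le_iff mult_nonneg_nonpos)
  have \<eta>: "\<eta> \<ge> 0" using noise t by (smt (verit) mult_neg_pos of_nat_0_less_iff)
  have C: "C \<ge> 0" using bound by (meson abs_ge_zero order_trans)
  \<comment> \<open>Expanding over next states moves the dependence on \<open>Q\<close> into the
    coefficients \<open>f y\<close> and leaves sums in which \<open>Q\<close> does not
    occur.\<close>
  have f_eq: "f z - row_dot (K i j) f = (\<Sum>y\<in>UNIV. f y * (of_bool (z = y) - pmf (K i j) y))" for z
    by (simp add: row_dot_def right_diff_distrib sum_subtractf mult.commute)
  have "n * mean_deviation \<gamma> r Q x u w t i j
      = (\<Sum>s\<in>visits x u t i j. (Q i j - row_dot (K i j) f) - w s - (f (x (Suc s)) - row_dot (K i j) f))"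
    using n unfolding mean_deviation_def n_def[symmetric] by (simp add: f_def algebra_simps)
  also have "\<dots> = n * expected_deviation \<gamma> K r Q i j - S
      - (\<Sum>s\<in>visits x u t i j. f (x (Suc s)) - row_dot (K i j) f)"
    unfolding S_def sum_visits[symmetric] sum_subtractf
    by (simp add: n_def expected_deviation_def f_def[abs_def] algebra_simps)
  also have "(\<Sum>s\<in>visits x u t i j. f (x (Suc s)) - row_dot (K i j) f) = (\<Sum>y\<in>UNIV. f y * N y)"
    unfolding f_eq N_def sum_visits[symmetric] sum_distrib_left by (rule sum.swap)
  finally have "n * (mean_deviation \<gamma> r Q x u w t i j - expected_deviation \<gamma> K r Q i j)
      = - (S + (\<Sum>y\<in>UNIV. f y * N y))"
    by (simp add: algebra_simps)
  then have "\<bar>n * (mean_deviation \<gamma> r Q x u w t i j - expected_deviation \<gamma> K r Q i j)\<bar>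
      = \<bar>S + (\<Sum>y\<in>UNIV. f y * N y)\<bar>"
    by (simp only: abs_minus_cancel)
  then have "n * \<bar>mean_deviation \<gamma> r Q x u w t i j - expected_deviation \<gamma> K r Q i j\<bar>
      = \<bar>S + (\<Sum>y\<in>UNIV. f y * N y)\<bar>"
    using n by (simp only: abs_mult abs_of_pos)
  also have "\<dots> \<le> \<bar>S\<bar> + (\<Sum>y\<in>UNIV. \<bar>f y * N y\<bar>)"
    using sum_abs[of "\<lambda>y. f y * N y" UNIV] by linarith
  also have "\<dots> \<le> \<eta> * real t + (\<Sum>y\<in>(UNIV :: 'x set). C * (\<eta> * real t))"
    using noise trans bound C
    by (intro add_mono sum_mono) (auto simp: S_def N_def f_def abs_mult intro!: mult_mono)
  also have "\<dots> = real t * (\<eta> * (real CARD('x) * C + 1))"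
    by (simp add: algebra_simps)
  also have "\<dots> \<le> (m * n) * (\<eta> * (real CARD('x) * C + 1))"
    using tn \<eta> C by (intro mult_right_mono) auto
  finally have "n * \<bar>mean_deviation \<gamma> r Q x u w t i j - expected_deviation \<gamma> K r Q i j\<bar>
      \<le> n * (m * \<eta> * (real CARD('x) * C + 1))"
    by (simp add: mult_ac)
  then show ?thesis using n unfolding m_def by (simp only: mult_le_cancel_left_pos)
qed

text \<open>Source of the factor in the threshold: the error of \<open>Q i j\<close> itself
  contributes \<open>e\<close>, the error of the discounted continuation value
  \<open>\<gamma> * e\<close>.\<close>

lemma expected_deviation_drift:
  assumes "0 \<le> \<gamma>" "estimate_ok Q0 Q e"
  shows "\<bar>expected_deviation \<gamma> K r Q i j - expected_deviation \<gamma> K r Q0 i j\<bar> \<le> (1 + \<gamma>) * e"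
proof -
  have close: "\<bar>Q i j - Q0 i j\<bar> \<le> e" for i j
    using assms(2) by (simp add: estimate_ok_def)
  have "\<bar>bellman \<gamma> K r Q i j - bellman \<gamma> K r Q0 i j\<bar> \<le> \<gamma> * e"
    by (rule bellman_contraction[OF assms(1) close])
  then show ?thesis
    using close[of i j] by (simp add: expected_deviation_def bellman_def algebra_simps abs_le_iff)
qed

lemma secure_expected_deviation:
  assumes "0 \<le> \<gamma>" "\<gamma> < 1"
  shows "expected_deviation \<gamma> p r (Qstar \<gamma> p r) i j = 0"
  using fun_cong[OF fun_cong[OF Qstar_bellman[OF assms, of p r]], of i j]
  by (simp add: expected_deviation_def bellman_def)

text \<open>The value drift is the difference of the expected deviations of \<open>Qstar\<close>
  under the two models, and the Bellman equation makes the one under the true model zero.\<close>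

lemma Phi_min_le_expected_deviation:
  fixes p :: "('x::finite, 'u::finite) kernel"
  assumes "0 \<le> \<gamma>" "\<gamma> < 1"
  shows "Phi_min \<gamma> p r phat \<le> \<bar>expected_deviation \<gamma> phat r (Qstar \<gamma> p r) i j\<bar>"
proof -
  let ?f = "\<lambda>(i, j). \<bar>\<Sum>y\<in>UNIV. (pmf (p i j) y - pmf (phat i j) y) * (r i j y + \<gamma> * vmax (Qstar \<gamma> p r) y)\<bar>"
  have "Phi_min \<gamma> p r phat \<le> ?f (i, j)"
    unfolding Phi_min_def by (rule Min_le) auto
  also have "\<dots> = \<bar>expected_deviation \<gamma> phat r (Qstar \<gamma> p r) i j - expected_deviation \<gamma> p r (Qstar \<gamma> p r) i j\<bar>"
    by (simp add: expected_deviation_def row_dot_def left_diff_distrib sum_subtractf)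
  finally show ?thesis by (simp add: secure_expected_deviation[OF assms])
qed

context detection_phase
begin

text \<open>A union bound over finitely many pairs and triples. The exceptional event involves no
  estimate.\<close>

lemma uniform_concentration:
  assumes "\<eta> > 0"
  obtains B where "\<And>t. B t \<in> events" "(\<lambda>t. prob (B t)) \<longlonglongrightarrow> 0"
    "\<And>t \<omega> i j. \<omega> \<in> space M - B t \<Longrightarrow> \<bar>\<Sum>s<t. of_bool (visiting i j s \<omega>) * W s \<omega>\<bar> \<le> \<eta> * real t"
    "\<And>t \<omega> i j y. \<omega> \<in> space M - B t \<Longrightarrow>
      \<bar>\<Sum>s<t. of_bool (visiting i j s \<omega>) * (of_bool (X (Suc s) \<omega> = y) - pmf (K i j) y)\<bar> \<le> \<eta> * real t"
proof -
  define N where "N t = (\<lambda>(i, j). {\<omega>\<in>space M. \<eta> * real t \<le> \<bar>\<Sum>s<t. of_bool (visiting i j s \<omega>) * W s \<omega>\<bar>})" for t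
  define T where "T t = (\<lambda>(i, j, y). {\<omega>\<in>space M. \<eta> * real t \<le>
    \<bar>\<Sum>s<t. of_bool (visiting i j s \<omega>) * (of_bool (X (Suc s) \<omega> = y) - pmf (K i j) y)\<bar>})" for t
  define B where "B t = (\<Union>k. N t k) \<union> (\<Union>k. T t k)" for t
  have N: "N t k \<in> events" for t k
    unfolding N_def of_bool_def by (cases k) simp
  have T: "T t k \<in> events" for t k
    unfolding T_def of_bool_def by (cases k) simp
  have "(\<lambda>t. prob (N t k)) \<longlonglongrightarrow> 0" for k
    using noise_weak_law[OF assms] by (cases k) (simp add: N_def)
  moreover have "(\<lambda>t. prob (T t k)) \<longlonglongrightarrow> 0" for k
    using transition_weak_law[OF assms] by (cases k) (simp add: T_def)
  ultimately have lim: "(\<lambda>t. (\<Sum>k\<in>UNIV. prob (N t k)) + (\<Sum>k\<in>UNIV. prob (T t k))) \<longlonglongrightarrow> 0"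
    by (intro tendsto_add_zero tendsto_null_sum)
  have le: "prob (B t) \<le> (\<Sum>k\<in>UNIV. prob (N t k)) + (\<Sum>k\<in>UNIV. prob (T t k))" for t
  proof -
    have "prob (B t) \<le> prob (\<Union>k. N t k) + prob (\<Union>k. T t k)"
      unfolding B_def using N T by (intro measure_Un_le) auto
    then show ?thesis
      using measure_UNION_le[of UNIV "N t" M] measure_UNION_le[of UNIV "T t" M] N T by fastforce
  qed
  show thesis
  proof (rule that[of B])
    show "B t \<in> events" for t
      unfolding B_def using N T by (intro sets.Un sets.countable_UN) auto
    show "(\<lambda>t. prob (B t)) \<longlonglongrightarrow> 0"
      by (rule tendsto_sandwich[OF _ _ tendsto_const lim]) (use le in auto)
    show "\<bar>\<Sum>s<t. of_bool (visiting i j s \<omega>) * W s \<omega>\<bar> \<le> \<eta> * real t" if "\<omega> \<in> space M - B t" for t \<omega> i j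
    proof -
      have "\<omega> \<notin> N t (i, j)" "\<omega> \<in> space M" using that by (auto simp: B_def)
      then show ?thesis by (auto simp: N_def)
    qed
    show "\<bar>\<Sum>s<t. of_bool (visiting i j s \<omega>) * (of_bool (X (Suc s) \<omega> = y) - pmf (K i j) y)\<bar> \<le> \<eta> * real t"
      if "\<omega> \<in> space M - B t" for t \<omega> i j y
    proof -
      have "\<omega> \<notin> T t (i, j, y)" "\<omega> \<in> space M" using that by (auto simp: B_def)
      then show ?thesis by (auto simp: T_def)
    qed
  qed
qed

text \<open>One event \<open>B t\<close> serves all estimates within \<open>e\<close> of
  \<open>Q0\<close>, since a single \<open>C\<close> bounds their coefficients. A random estimate
  can thus be inserted point by point, whatever its dependence on the trajectory.\<close>

lemma deviation_concentration:
  fixes Q0 :: "('x, 'u) qfun" and r :: "('x, 'u) rewards"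
  assumes "\<delta> > 0"
  obtains B where "\<And>t. B t \<in> events" "(\<lambda>t. prob (B t)) \<longlonglongrightarrow> 0"
    "\<And>t \<omega> Q i j. \<omega> \<in> space M - B t \<Longrightarrow> t > 0 \<Longrightarrow> estimate_ok Q0 Q e \<Longrightarrow>
      (i, j) \<in> retained (\<lambda>s. X s \<omega>) (\<lambda>s. U s \<omega>) t \<Longrightarrow>
      \<bar>mean_deviation \<gamma> r Q (\<lambda>s. X s \<omega>) (\<lambda>s. U s \<omega>) (\<lambda>s. W s \<omega>) t i j
        - expected_deviation \<gamma> K r Q i j\<bar> \<le> \<delta>"
proof -
  obtain C1 where C1: "\<And>k. \<bar>(\<lambda>(i, j, y). r i j y + \<gamma> * vmax Q0 y) k\<bar> \<le> C1"
    using finite_family_bounded by blast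
  define C where "C = \<bar>C1\<bar> + \<bar>\<gamma> * e\<bar>"
  have C: "\<bar>r i j y + \<gamma> * vmax Q y\<bar> \<le> C" if "estimate_ok Q0 Q e" for Q i j y
  proof -
    have "\<bar>vmax Q y - vmax Q0 y\<bar> \<le> e"
      using that by (intro abs_vmax_diff_le) (auto simp: estimate_ok_def)
    then have "\<bar>\<gamma> * (vmax Q y - vmax Q0 y)\<bar> \<le> \<bar>\<gamma> * e\<bar>"
      unfolding abs_mult by (intro mult_left_mono) auto
    moreover have "r i j y + \<gamma> * vmax Q y = (r i j y + \<gamma> * vmax Q0 y) + \<gamma> * (vmax Q y - vmax Q0 y)"
      by (simp add: algebra_simps)
    ultimately show ?thesis using C1[of "(i, j, y)"] unfolding C_def by simp
  qed
  \<comment> \<open>The constant of \<open>mean_deviation_close\<close> with \<open>\<eta>\<close>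
    taken out, so that \<open>\<eta> = \<delta> / c\<close> yields exactly
    \<open>\<delta>\<close>.\<close>
  define c where "c = 2 * real CARD('x) * real CARD('u) * (real CARD('x) * C + 1)"
  have "c > 0" unfolding c_def C_def by (intro mult_pos_pos add_nonneg_pos) auto
  then have "\<delta> / c > 0" using assms by simp
  then show thesis
  proof (rule uniform_concentration)
    fix B assume B: "\<And>t. B t \<in> events" "(\<lambda>t. prob (B t)) \<longlonglongrightarrow> 0"
      "\<And>t \<omega> i j. \<omega> \<in> space M - B t \<Longrightarrow> \<bar>\<Sum>s<t. of_bool (visiting i j s \<omega>) * W s \<omega>\<bar> \<le> \<delta> / c * real t"
      "\<And>t \<omega> i j y. \<omega> \<in> space M - B t \<Longrightarrow>
        \<bar>\<Sum>s<t. of_bool (visiting i j s \<omega>) * (of_bool (X (Suc s) \<omega> = y) - pmf (K i j) y)\<bar> \<le> \<delta> / c * real t"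
    show thesis
    proof (rule that[OF B(1,2)])
      fix t \<omega> Q i j
      assume *: "\<omega> \<in> space M - B t" "t > 0" "estimate_ok Q0 Q e"
        "(i, j) \<in> retained (\<lambda>s. X s \<omega>) (\<lambda>s. U s \<omega>) t"
      have "\<bar>mean_deviation \<gamma> r Q (\<lambda>s. X s \<omega>) (\<lambda>s. U s \<omega>) (\<lambda>s. W s \<omega>) t i j - expected_deviation \<gamma> K r Q i j\<bar>
          \<le> 2 * real CARD('x) * real CARD('u) * (\<delta> / c) * (real CARD('x) * C + 1)"
        using * B(3,4) C by (intro mean_deviation_close) auto
      also have "\<dots> = \<delta> / c * c" by (simp add: c_def mult_ac)
      also have "\<dots> = \<delta>" using \<open>c > 0\<close> by simp
      finally show "\<bar>mean_deviation \<gamma> r Q (\<lambda>s. X s \<omega>) (\<lambda>s. U s \<omega>) (\<lambda>s. W s \<omega>) t i j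
          - expected_deviation \<gamma> K r Q i j\<bar> \<le> \<delta>" .
    qed
  qed
qed

section \<open>Measurability of the estimate-dependent events, and the two limits\<close>

lemma vmax_measurable:
  fixes Q :: "'w \<Rightarrow> ('x, 'u) qfun"
  assumes "\<And>i j. (\<lambda>\<omega>. Q \<omega> i j) \<in> borel_measurable M"
  shows "(\<lambda>\<omega>. vmax (Q \<omega>) y) \<in> borel_measurable M"
  unfolding vmax_def using assms by (intro borel_measurable_Max) auto

lemma declares_breach_measurable:
  fixes Q :: "'w \<Rightarrow> ('x, 'u) qfun"
  assumes Q[measurable]: "\<And>i j. (\<lambda>\<omega>. Q \<omega> i j) \<in> borel_measurable M" and "t > 0"
  shows "Measurable.pred M (\<lambda>\<omega>. declares_breach \<gamma> r thr (Q \<omega>) (\<lambda>s. X s \<omega>) (\<lambda>s. U s \<omega>) (\<lambda>s. W s \<omega>) t)"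
proof -
  have v[measurable]: "(\<lambda>\<omega>. vmax (Q \<omega>) (X s \<omega>)) \<in> borel_measurable M" for s
    by (rule measurable_compose_countable[OF vmax_measurable[OF Q]]) simp
  have [measurable]: "(\<lambda>\<omega>. r i j (X s \<omega>)) \<in> borel_measurable M" for i j s
    by simp
  show ?thesis
    unfolding declares_breach_iff[OF \<open>t > 0\<close>] mean_deviation_def retained_def mem_Collect_eq case_prod_conv
      sum_visits card_visits of_bool_def
    by measurable
qed

lemma expected_deviation_measurable:
  fixes Q :: "'w \<Rightarrow> ('x, 'u) qfun"
  assumes [measurable]: "\<And>i j. (\<lambda>\<omega>. Q \<omega> i j) \<in> borel_measurable M"
  shows "(\<lambda>\<omega>. expected_deviation \<gamma> K r (Q \<omega>) i j) \<in> borel_measurable M"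
  using vmax_measurable[OF assms] unfolding expected_deviation_def row_dot_def by measurable

lemma estimate_ok_measurable:
  fixes Q :: "'w \<Rightarrow> ('x, 'u) qfun"
  assumes [measurable]: "\<And>i j. (\<lambda>\<omega>. Q \<omega> i j) \<in> borel_measurable M"
  shows "Measurable.pred M (\<lambda>\<omega>. estimate_ok Q0 (Q \<omega>) e)"
  unfolding estimate_ok_def by measurable

text \<open>All pairs exceed the threshold by more than \<open>\<delta>\<close>, so outside the
  exceptional event any retained pair triggers a breach, whichever pairs the policy favours.
  Conditioning on a fixed event of positive probability only divides the exceptional probability by
  a constant.\<close>

lemma breach_detected:
  fixes Q :: "'w \<Rightarrow> ('x, 'u) qfun"
  assumes Q[measurable]: "\<And>i j. (\<lambda>\<omega>. Q \<omega> i j) \<in> borel_measurable M"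
    and ok: "\<P>(\<omega> in M. estimate_ok Q0 (Q \<omega>) e) > 0"
    and margin: "\<delta> > 0" "\<And>i j Q. estimate_ok Q0 Q e \<Longrightarrow> thr + \<delta> < \<bar>expected_deviation \<gamma> K r Q i j\<bar>"
  shows "(\<lambda>t. \<P>(\<omega> in M. declares_breach \<gamma> r thr (Q \<omega>) (\<lambda>s. X s \<omega>) (\<lambda>s. U s \<omega>) (\<lambda>s. W s \<omega>) t
    \<bar> estimate_ok Q0 (Q \<omega>) e)) \<longlonglongrightarrow> 1"
proof -
  let ?ok = "{\<omega>\<in>space M. estimate_ok Q0 (Q \<omega>) e}"
  let ?br = "\<lambda>t. {\<omega>\<in>space M. declares_breach \<gamma> r thr (Q \<omega>) (\<lambda>s. X s \<omega>) (\<lambda>s. U s \<omega>) (\<lambda>s. W s \<omega>) t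
    \<and> estimate_ok Q0 (Q \<omega>) e}"
  show ?thesis
  proof (rule deviation_concentration[OF margin(1), of Q0 e \<gamma> r])
    fix B assume B: "\<And>t. B t \<in> events" "(\<lambda>t. prob (B t)) \<longlonglongrightarrow> 0"
      "\<And>t \<omega> Q i j. \<omega> \<in> space M - B t \<Longrightarrow> t > 0 \<Longrightarrow> estimate_ok Q0 Q e \<Longrightarrow>
        (i, j) \<in> retained (\<lambda>s. X s \<omega>) (\<lambda>s. U s \<omega>) t \<Longrightarrow>
        \<bar>mean_deviation \<gamma> r Q (\<lambda>s. X s \<omega>) (\<lambda>s. U s \<omega>) (\<lambda>s. W s \<omega>) t i j
          - expected_deviation \<gamma> K r Q i j\<bar> \<le> \<delta>"
    note [measurable] = estimate_ok_measurable[OF Q] B(1)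
    have lower: "1 - prob (B t) / prob ?ok \<le> prob (?br t) / prob ?ok" if t: "t > 0" for t
    proof -
      note [measurable] = declares_breach_measurable[OF Q t]
      have "?ok \<subseteq> ?br t \<union> B t"
      proof
        fix \<omega> assume \<omega>: "\<omega> \<in> ?ok"
        obtain i j where ij: "(i, j) \<in> retained (\<lambda>s. X s \<omega>) (\<lambda>s. U s \<omega>) t"
          using retained_nonempty[OF t] by fast
        show "\<omega> \<in> ?br t \<union> B t"
        proof (cases "\<omega> \<in> B t")
          case False
          then have "thr < \<bar>mean_deviation \<gamma> r (Q \<omega>) (\<lambda>s. X s \<omega>) (\<lambda>s. U s \<omega>) (\<lambda>s. W s \<omega>) t i j\<bar>"
            using B(3)[of \<omega> t "Q \<omega>" i j] margin(2)[of "Q \<omega>" i j] \<omega> t ij by simp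
          then show ?thesis using \<omega> ij t by (auto simp: declares_breach_iff)
        qed simp
      qed
      then have "prob ?ok \<le> prob (?br t \<union> B t)" by (intro finite_measure_mono) measurable
      also have "\<dots> \<le> prob (?br t) + prob (B t)" by (intro measure_Un_le) measurable
      finally have "(prob ?ok - prob (B t)) / prob ?ok \<le> prob (?br t) / prob ?ok"
        by (intro divide_right_mono) auto
      then show ?thesis using ok by (simp add: diff_divide_distrib)
    qed
    have upper: "prob (?br t) / prob ?ok \<le> 1" for t
    proof -
      have "prob (?br t) \<le> prob ?ok" by (intro finite_measure_mono) (auto, measurable)
      then show ?thesis using ok by simp
    qed
    have "(\<lambda>t. 1 - prob (B t) / prob ?ok) \<longlonglongrightarrow> 1 - 0 / prob ?ok"
      using ok B(2) by (intro tendsto_intros) auto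
    then have lim: "(\<lambda>t. 1 - prob (B t) / prob ?ok) \<longlonglongrightarrow> 1" by simp
    show ?thesis
      unfolding cond_prob_def
    proof (rule tendsto_sandwich[OF _ _ lim tendsto_const])
      show "\<forall>\<^sub>F t in sequentially. 1 - prob (B t) / prob ?ok \<le> prob (?br t) / prob ?ok"
        using lower by (intro eventually_sequentiallyI[of 1]) auto
      show "\<forall>\<^sub>F t in sequentially. prob (?br t) / prob ?ok \<le> 1"
        using upper by (intro always_eventually allI)
    qed
  qed
qed

text \<open>The bound \<open>below\<close> leaves no uniform margin. The events \<open>L n\<close>
  that some expected deviation comes within \<open>inverse (real (Suc n))\<close> of the threshold
  decrease to the tie, a null event by \<open>no_tie\<close>. Hence \<open>n\<close> is chosen to
  make \<open>L n\<close> improbable, and only then is the sampling error made smaller than this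
  distance.\<close>

lemma no_false_alarm:
  fixes Q :: "'w \<Rightarrow> ('x, 'u) qfun"
  assumes Q[measurable]: "\<And>i j. (\<lambda>\<omega>. Q \<omega> i j) \<in> borel_measurable M"
    and ok: "\<P>(\<omega> in M. estimate_ok Q0 (Q \<omega>) e) > 0"
    and below: "\<And>i j Q. estimate_ok Q0 Q e \<Longrightarrow> \<bar>expected_deviation \<gamma> K r Q i j\<bar> \<le> thr"
    and no_tie: "AE \<omega> in M. estimate_ok Q0 (Q \<omega>) e \<longrightarrow> (\<forall>i j. \<bar>expected_deviation \<gamma> K r (Q \<omega>) i j\<bar> \<noteq> thr)"
  shows "(\<lambda>t. \<P>(\<omega> in M. declares_breach \<gamma> r thr (Q \<omega>) (\<lambda>s. X s \<omega>) (\<lambda>s. U s \<omega>) (\<lambda>s. W s \<omega>) t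
    \<bar> estimate_ok Q0 (Q \<omega>) e)) \<longlonglongrightarrow> 0"
proof -
  let ?br = "\<lambda>t. {\<omega>\<in>space M. declares_breach \<gamma> r thr (Q \<omega>) (\<lambda>s. X s \<omega>) (\<lambda>s. U s \<omega>) (\<lambda>s. W s \<omega>) t
    \<and> estimate_ok Q0 (Q \<omega>) e}"
  define L where "L n = {\<omega>\<in>space M. estimate_ok Q0 (Q \<omega>) e \<and>
    (\<exists>i j. thr - inverse (real (Suc n)) \<le> \<bar>expected_deviation \<gamma> K r (Q \<omega>) i j\<bar>)}" for n
  note [measurable] = estimate_ok_measurable[OF Q] expected_deviation_measurable[OF Q]
  have L[measurable]: "L n \<in> events" for n
    unfolding L_def by measurable
  have "decseq L"
  proof (rule decseq_SucI)
    fix n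
    have le: "inverse (real (Suc (Suc n))) \<le> inverse (real (Suc n))" by (simp add: field_simps)
    show "L (Suc n) \<subseteq> L n"
    proof
      fix \<omega> assume "\<omega> \<in> L (Suc n)"
      then obtain i j where \<omega>: "\<omega> \<in> space M" "estimate_ok Q0 (Q \<omega>) e"
        and "thr - inverse (real (Suc (Suc n))) \<le> \<bar>expected_deviation \<gamma> K r (Q \<omega>) i j\<bar>"
        unfolding L_def by blast
      then have "thr - inverse (real (Suc n)) \<le> \<bar>expected_deviation \<gamma> K r (Q \<omega>) i j\<bar>"
        using le by linarith
      then show "\<omega> \<in> L n" unfolding L_def using \<omega> by blast
    qed
  qed
  then have "(\<lambda>n. prob (L n)) \<longlonglongrightarrow> prob (\<Inter>n. L n)"
    by (intro finite_Lim_measure_decseq) auto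
  moreover have "prob (\<Inter>n. L n) = 0"
  proof -
    have "(\<Inter>n. L n) \<subseteq> {\<omega>\<in>space M. estimate_ok Q0 (Q \<omega>) e \<and> (\<exists>i j. \<bar>expected_deviation \<gamma> K r (Q \<omega>) i j\<bar> = thr)}"
    proof
      fix \<omega> assume \<omega>: "\<omega> \<in> (\<Inter>n. L n)"
      then have space: "\<omega> \<in> space M" "estimate_ok Q0 (Q \<omega>) e" by (auto simp: L_def)
      \<comment> \<open>The pair witnessing \<open>L n\<close> may change with \<open>n\<close>; the
        largest deviation is a single number that works for all \<open>n\<close>.\<close>
      define m where "m = Max (range (\<lambda>(i, j). \<bar>expected_deviation \<gamma> K r (Q \<omega>) i j\<bar>))"
      have "m \<in> range (\<lambda>(i, j). \<bar>expected_deviation \<gamma> K r (Q \<omega>) i j\<bar>)"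
        unfolding m_def by (rule Max_in) auto
      then obtain i j where ij: "m = \<bar>expected_deviation \<gamma> K r (Q \<omega>) i j\<bar>" by auto
      have "thr - inverse (real (Suc n)) \<le> m" for n
      proof -
        have "\<omega> \<in> L n" using \<omega> by blast
        then obtain i' j' where ij': "thr - inverse (real (Suc n)) \<le> \<bar>expected_deviation \<gamma> K r (Q \<omega>) i' j'\<bar>"
          by (auto simp: L_def)
        also have "\<dots> \<le> m" unfolding m_def by (rule Max_ge) (auto intro: range_eqI[of _ _ "(i', j')"])
        finally show ?thesis .
      qed
      moreover have "(\<lambda>n. thr - inverse (real (Suc n))) \<longlonglongrightarrow> thr - 0"
        by (intro tendsto_intros LIMSEQ_inverse_real_of_nat)
      ultimately have "thr - 0 \<le> m" by (intro LIMSEQ_le_const2) auto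
      then have "m = thr" using below[OF space(2), of i j] ij by simp
      then show "\<omega> \<in> {\<omega>\<in>space M. estimate_ok Q0 (Q \<omega>) e \<and> (\<exists>i j. \<bar>expected_deviation \<gamma> K r (Q \<omega>) i j\<bar> = thr)}"
        using space ij by auto
    qed
    with no_tie have "AE \<omega> in M. \<omega> \<notin> (\<Inter>n. L n)"
      by (elim eventually_mono) blast
    then show ?thesis
      by (intro prob_eq_0[THEN iffD2]) auto
  qed
  ultimately have L_lim: "(\<lambda>n. prob (L n)) \<longlonglongrightarrow> 0" by simp
  have "(\<lambda>t. prob (?br t)) \<longlonglongrightarrow> 0"
  proof (rule LIMSEQ_I)
    fix a :: real assume "0 < a"
    then have "\<forall>\<^sub>F n in sequentially. prob (L n) < a / 2"
      using L_lim by (intro order_tendstoD) auto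
    then obtain n where n: "prob (L n) < a / 2" by (auto simp: eventually_sequentially)
    have "inverse (real (Suc n)) / 2 > 0" by simp
    then show "\<exists>t0. \<forall>t\<ge>t0. norm (prob (?br t) - 0) < a"
    proof (rule deviation_concentration[of _ Q0 e \<gamma> r])
      fix B assume B: "\<And>t. B t \<in> events" "(\<lambda>t. prob (B t)) \<longlonglongrightarrow> 0"
        "\<And>t \<omega> Q i j. \<omega> \<in> space M - B t \<Longrightarrow> t > 0 \<Longrightarrow> estimate_ok Q0 Q e \<Longrightarrow>
          (i, j) \<in> retained (\<lambda>s. X s \<omega>) (\<lambda>s. U s \<omega>) t \<Longrightarrow>
          \<bar>mean_deviation \<gamma> r Q (\<lambda>s. X s \<omega>) (\<lambda>s. U s \<omega>) (\<lambda>s. W s \<omega>) t i j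
            - expected_deviation \<gamma> K r Q i j\<bar> \<le> inverse (real (Suc n)) / 2"
      note [measurable] = B(1)
      have "\<forall>\<^sub>F t in sequentially. prob (B t) < a / 2"
        using B(2) \<open>0 < a\<close> by (intro order_tendstoD) auto
      then obtain t0 where t0: "\<And>t. t0 \<le> t \<Longrightarrow> prob (B t) < a / 2" by (auto simp: eventually_sequentially)
      show "\<exists>t0. \<forall>t\<ge>t0. norm (prob (?br t) - 0) < a"
      proof (intro exI[of _ "max 1 t0"] allI impI)
        fix t assume t: "max 1 t0 \<le> t"
        have "?br t \<subseteq> L n \<union> B t"
        proof
          fix \<omega> assume \<omega>: "\<omega> \<in> ?br t"
          then obtain i j where ij: "(i, j) \<in> retained (\<lambda>s. X s \<omega>) (\<lambda>s. U s \<omega>) t"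
            "thr < \<bar>mean_deviation \<gamma> r (Q \<omega>) (\<lambda>s. X s \<omega>) (\<lambda>s. U s \<omega>) (\<lambda>s. W s \<omega>) t i j\<bar>"
            using t by (auto simp: declares_breach_iff)
          show "\<omega> \<in> L n \<union> B t"
          proof (cases "\<omega> \<in> B t")
            case False
            then have "\<bar>mean_deviation \<gamma> r (Q \<omega>) (\<lambda>s. X s \<omega>) (\<lambda>s. U s \<omega>) (\<lambda>s. W s \<omega>) t i j
                - expected_deviation \<gamma> K r (Q \<omega>) i j\<bar> \<le> inverse (real (Suc n)) / 2"
              using \<omega> t ij by (intro B(3)) auto
            then have "thr - inverse (real (Suc n)) \<le> \<bar>expected_deviation \<gamma> K r (Q \<omega>) i j\<bar>"
              using ij(2) \<open>inverse (real (Suc n)) / 2 > 0\<close> by linarith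
            then show ?thesis using \<omega> by (auto simp: L_def)
          qed simp
        qed
        then have "prob (?br t) \<le> prob (L n \<union> B t)" by (intro finite_measure_mono) measurable
        also have "\<dots> \<le> prob (L n) + prob (B t)" by (intro measure_Un_le) measurable
        also have "\<dots> < a / 2 + a / 2" using n t0[of t] t by (intro add_strict_mono) auto
        finally show "norm (prob (?br t) - 0) < a" by simp
      qed
    qed
  qed
  then show ?thesis unfolding cond_prob_def by (rule tendsto_divide_zero)
qed

end

section \<open>Sufficiency of the information advantage\<close>

lemma information_advantage_sufficient:
  assumes \<gamma>: "0 \<le> \<gamma>" "\<gamma> < 1" and adv: "Phi_min \<gamma> p r phat > 2 * (1 + \<gamma>) * \<epsilon>bar"
  shows "breach_guarantee TYPE('w) \<gamma> p r phat \<epsilon>bar"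
  unfolding breach_guarantee_def
proof (intro allI impI conjI)
  fix \<nu> and M :: "'w measure" and F X U W Qhat \<epsilon> ta
  assume noise: "zero_mean_noise \<nu>" and learned: "learned_estimates M (Qstar \<gamma> p r) Qhat \<epsilon>"
    and ok: "\<P>(\<omega> in M. estimate_ok (Qstar \<gamma> p r) (Qhat ta \<omega>) (\<epsilon> ta)) > 0" and \<epsilon>: "\<epsilon> ta \<le> \<epsilon>bar"
  have Q: "(\<lambda>\<omega>. Qhat ta \<omega> i j) \<in> borel_measurable M" for i j
    using learned by (simp add: learned_estimates_def)
  have thr: "(1 + \<gamma>) * \<epsilon> ta \<le> (1 + \<gamma>) * \<epsilon>bar"
    using \<epsilon> \<gamma> by (intro mult_left_mono) auto
  {
    assume "controlled_process phat \<nu> M F X U W"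
    then interpret detection_phase phat \<nu> M F X U W
      using noise by unfold_locales
    \<comment> \<open>Half of the gap: under attack the expected deviations exceed the threshold by
      at least twice this amount.\<close>
    let ?\<delta> = "(Phi_min \<gamma> p r phat - 2 * (1 + \<gamma>) * \<epsilon>bar) / 2"
    show "(\<lambda>tc. \<P>(\<omega> in M. declares_breach \<gamma> r ((1 + \<gamma>) * \<epsilon>bar) (Qhat ta \<omega>)
        (\<lambda>s. X s \<omega>) (\<lambda>s. U s \<omega>) (\<lambda>s. W s \<omega>) tc
        \<bar> estimate_ok (Qstar \<gamma> p r) (Qhat ta \<omega>) (\<epsilon> ta))) \<longlonglongrightarrow> 1"
    proof (rule breach_detected[OF Q ok, of ?\<delta>])
      show "?\<delta> > 0" using adv by simp
      fix i j Q assume "estimate_ok (Qstar \<gamma> p r) Q (\<epsilon> ta)"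
      from expected_deviation_drift[OF \<gamma>(1) this, of phat r i j]
      show "(1 + \<gamma>) * \<epsilon>bar + ?\<delta> < \<bar>expected_deviation \<gamma> phat r Q i j\<bar>"
        using Phi_min_le_expected_deviation[OF \<gamma>, of p r phat i j] thr adv by (simp add: field_simps)
    qed
  next
    assume "controlled_process p \<nu> M F X U W"
    then interpret detection_phase p \<nu> M F X U W
      using noise by unfold_locales
    assume no_tie: "AE \<omega> in M. estimate_ok (Qstar \<gamma> p r) (Qhat ta \<omega>) (\<epsilon> ta) \<longrightarrow>
      (\<forall>i j. \<bar>expected_deviation \<gamma> p r (Qhat ta \<omega>) i j\<bar> \<noteq> (1 + \<gamma>) * \<epsilon>bar)"
    show "(\<lambda>tc. \<P>(\<omega> in M. declares_breach \<gamma> r ((1 + \<gamma>) * \<epsilon>bar) (Qhat ta \<omega>)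
        (\<lambda>s. X s \<omega>) (\<lambda>s. U s \<omega>) (\<lambda>s. W s \<omega>) tc
        \<bar> estimate_ok (Qstar \<gamma> p r) (Qhat ta \<omega>) (\<epsilon> ta))) \<longlonglongrightarrow> 0"
    proof (rule no_false_alarm[OF Q ok _ no_tie])
      fix i j Q assume "estimate_ok (Qstar \<gamma> p r) Q (\<epsilon> ta)"
      from expected_deviation_drift[OF \<gamma>(1) this, of p r i j]
      show "\<bar>expected_deviation \<gamma> p r Q i j\<bar> \<le> (1 + \<gamma>) * \<epsilon>bar"
        using thr by (simp add: secure_expected_deviation[OF \<gamma>])
    qed
  }
qed

subsection \<open>Necessity\<close>

lemma Phi_min_nonneg:
  fixes p :: "('x::finite, 'u::finite) kernel"
  shows "0 \<le> Phi_min \<gamma> p r phat"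
proof -
  let ?f = "\<lambda>(i, j). \<bar>\<Sum>y\<in>UNIV. (pmf (p i j) y - pmf (phat i j) y) * (r i j y + \<gamma> * vmax (Qstar \<gamma> p r) y)\<bar>"
  have "Min (range ?f) \<in> range ?f" by (rule Min_in) auto
  then show ?thesis unfolding Phi_min_def by auto
qed

text \<open>Over a single state all distributions coincide and the drift vanishes. A positive drift
  thus supplies the two states between which the undetected attack alternates.\<close>

lemma Phi_min_pos_two_states:
  fixes p :: "('x::finite, 'u::finite) kernel"
  assumes "Phi_min \<gamma> p r phat \<noteq> 0"
  obtains a b :: 'x where "a \<noteq> b"
proof (rule ccontr)
  assume *: "\<not> thesis"
  then have eq: "y = z" for y z :: 'x using that by blast
  have "set_pmf q \<subseteq> {y}" for q and y :: 'x using eq by blast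
  then have "pmf q y = 1" for q and y :: 'x
    using sum_pmf_eq_1[of "{y}" q] by simp
  then have "Phi_min \<gamma> p r phat = Min (range (\<lambda>_ :: 'x \<times> 'u. 0))"
    unfolding Phi_min_def by (simp add: case_prod_unfold)
  then show False using assms by simp
qed

section \<open>Ingredients of a deterministic counterexample\<close>

lemma measure_return_count: "measure (return (count_space UNIV) a) A = indicator A a"
  by (simp add: measure_return)

text \<open>Under a point mass all events have probability 0 or 1, and the trajectory ignores the
  sample point, so the full sigma-algebra can serve at every time. The kernel has to be
  deterministic only along the path.\<close>

lemma controlled_process_deterministic:
  fixes K :: "('x::finite, 'u::finite) kernel" and a :: 'w
  assumes "\<And>t. K (x t) (u t) = return_pmf (x (Suc t))"
  defines "M \<equiv> return (count_space UNIV) a"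
  shows "controlled_process K (return borel 0) M (\<lambda>_. M) (\<lambda>t _. x t) (\<lambda>t _. u t) (\<lambda>_ _. 0)"
proof -
  interpret prob_space M unfolding M_def by (rule prob_space_return) simp
  have "measure M {\<omega> \<in> A. x t = i \<and> u t = j \<and> x (Suc t) = y \<and> 0 \<in> B}
      = measure M {\<omega> \<in> A. x t = i \<and> u t = j} * pmf (K i j) y * measure (return borel 0) B"
    if B: "B \<in> sets borel" for t i j y A and B :: "real set"
  proof -
    have "measure (return borel 0) B = indicator B 0"
      using B by (simp add: measure_return)
    then show ?thesis
      using assms(1)[of t] unfolding M_def measure_return_count by (auto simp: indicator_def)
  qed
  then show ?thesis
    unfolding controlled_process_def filtration_def subalgebra_def
    using prob_space_axioms by auto
qed

lemma zero_mean_noise_zero: "zero_mean_noise (return borel 0)"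
  unfolding zero_mean_noise_def
  by (auto simp: prob_space_return integral_return integrable_iff_bounded nn_integral_return)

text \<open>Rewards for changing state are never collected under the true model, so they can be set
  freely to create a drift without disturbing \<open>Qstar\<close>.\<close>

lemma Qstar_absorbing:
  assumes "0 \<le> \<gamma>" "\<gamma> < 1" "\<And>x u. p x u = return_pmf x" "\<And>x u. r x u x = 0"
  shows "Qstar \<gamma> p r x u = 0"
proof -
  have "policy_return \<gamma> p r \<pi> n h x = 0" for \<pi> n h x
    by (induction n arbitrary: h x) (simp_all add: assms row_dot_return)
  then have "policy_q \<gamma> p r \<pi> x u = 0" for \<pi>
    by (simp add: policy_q_def assms row_dot_return)
  then show ?thesis by (simp add: Qstar_def)
qed

text \<open>The undetected attack: truly every state is absorbing and unrewarded, so \<open>Qstar = 0\<close>, while the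
  adversary shows an alternation of \<open>a\<close> and \<open>b\<close> with rewards \<open>\<phi>\<close> and \<open>- \<phi>\<close>. The estimate has error
  \<open>\<epsilon>bar\<close> at \<open>a\<close> and \<open>- \<epsilon>bar\<close> at \<open>b\<close>, which shifts each sample deviation towards \<open>0\<close> by the full
  \<open>(1 + \<gamma>) * \<epsilon>bar\<close>. For \<open>\<phi> = 0\<close> the two states may coincide. Everything is deterministic, so that
  any sample space \<open>'w\<close> carries the example.\<close>

lemma information_advantage_necessary:
  fixes p phat :: "('x::finite, 'u::finite) kernel"
  assumes \<gamma>: "0 \<le> \<gamma>" "\<gamma> < 1" and no_adv: "Phi_min \<gamma> p r phat \<le> 2 * (1 + \<gamma>) * \<epsilon>bar"
  obtains p' phat' :: "('x, 'u) kernel" and r' where "Phi_min \<gamma> p' r' phat' = Phi_min \<gamma> p r phat"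
    "\<not> breach_guarantee TYPE('w) \<gamma> p' r' phat' \<epsilon>bar"
proof -
  define \<phi> where "\<phi> = Phi_min \<gamma> p r phat"
  have \<phi>: "0 \<le> \<phi>" "\<phi> \<le> 2 * ((1 + \<gamma>) * \<epsilon>bar)"
    using no_adv Phi_min_nonneg[of \<gamma> p r phat] by (simp_all add: \<phi>_def algebra_simps)
  then have \<epsilon>: "0 \<le> \<epsilon>bar" using \<gamma> by (smt (verit) mult_pos_neg)
  obtain a b :: 'x where ab: "\<phi> \<noteq> 0 \<Longrightarrow> a \<noteq> b"
    using Phi_min_pos_two_states unfolding \<phi>_def by metis
  define p' :: "('x, 'u) kernel" where "p' = (\<lambda>x u. return_pmf x)"
  define phat' :: "('x, 'u) kernel" where "phat' = (\<lambda>x u. return_pmf (if x = a then b else a))"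
  define r' :: "('x, 'u) rewards" where "r' = (\<lambda>x u y. if x = y then 0 else if x = a then \<phi> else - \<phi>)"
  define Q :: "('x, 'u) qfun" where "Q = (\<lambda>x u. if x = a then \<epsilon>bar else - \<epsilon>bar)"
  define x where "x s = (if even s then a else b)" for s :: nat
  \<comment> \<open>Neither kernels, rewards nor estimate depend on the action, so an arbitrary one
    serves.\<close>
  define u where "u s = (undefined :: 'u)" for s :: nat
  have Qstar: "Qstar \<gamma> p' r' = (\<lambda>_ _. 0)"
    by (intro ext Qstar_absorbing[OF \<gamma>]) (auto simp: p'_def r'_def)
  have vmax_const: "vmax (\<lambda>y _. f y) y = f y" for f :: "'x \<Rightarrow> real" and y
    by (simp add: vmax_def)
  have vmax_Q: "vmax Q y = (if y = a then \<epsilon>bar else - \<epsilon>bar)" for y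
    unfolding Q_def by (rule vmax_const)
  have "Phi_min \<gamma> p' r' phat' = Min (range (\<lambda>_ :: 'x \<times> 'u. \<phi>))"
  proof -
    have "\<bar>\<Sum>y\<in>UNIV. (pmf (p' i j) y - pmf (phat' i j) y) * (r' i j y + \<gamma> * vmax (Qstar \<gamma> p' r') y)\<bar> = \<phi>" for i j
    proof -
      have "(\<Sum>y\<in>UNIV. (pmf (p' i j) y - pmf (phat' i j) y) * (r' i j y + \<gamma> * vmax (Qstar \<gamma> p' r') y))
          = row_dot (p' i j) (r' i j) - row_dot (phat' i j) (r' i j)"
        by (simp add: Qstar vmax_const row_dot_def left_diff_distrib sum_subtractf)
      also have "\<dots> = - r' i j (if i = a then b else a)"
        by (simp add: p'_def phat'_def row_dot_return) (simp add: r'_def)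
      finally show ?thesis using ab \<phi>(1) by (auto simp: r'_def)
    qed
    then show ?thesis unfolding Phi_min_def by simp
  qed
  then have Phi: "Phi_min \<gamma> p' r' phat' = \<phi>" by simp
  have undetected: "\<not> declares_breach \<gamma> r' ((1 + \<gamma>) * \<epsilon>bar) Q x u (\<lambda>_. 0) t" if t: "t > 0" for t
  proof
    assume "declares_breach \<gamma> r' ((1 + \<gamma>) * \<epsilon>bar) Q x u (\<lambda>_. 0) t"
    then obtain i j where ret: "(i, j) \<in> retained x u t"
      and large: "\<bar>mean_deviation \<gamma> r' Q x u (\<lambda>_. 0) t i j\<bar> > (1 + \<gamma>) * \<epsilon>bar"
      using t by (auto simp: declares_breach_iff)
    define V where "V = visits x u t i j"
    have "0 \<le> real t / (2 * real CARD('x) * real CARD('u))" by simp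
    also have "\<dots> < real (card V)" using ret by (simp add: retained_def V_def)
    finally have V: "real (card V) > 0" .
    \<comment> \<open>If \<open>a\<close> and \<open>b\<close> differ, each term is
      \<open>(1 + \<gamma>) * \<epsilon>bar - \<phi>\<close> at \<open>a\<close> and its negative at
      \<open>b\<close>; \<open>0 \<le> \<phi> \<le> 2 * (1 + \<gamma>) * \<epsilon>bar\<close>
      confines both to the threshold. At the upper end the threshold is met exactly, which the
      strict test does not report.\<close>
    have term_bound: "\<bar>Q i j - r' i j (x (Suc s)) - 0 - \<gamma> * vmax Q (x (Suc s))\<bar> \<le> (1 + \<gamma>) * \<epsilon>bar" if "s \<in> V" for s
    proof -
      have "x s = i" using that by (simp add: V_def visits_def)
      moreover have "\<gamma> * \<epsilon>bar \<ge> 0" using \<gamma> \<epsilon> by simp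
      ultimately show ?thesis
        using \<phi> \<epsilon> ab unfolding vmax_Q by (auto simp: x_def Q_def r'_def algebra_simps abs_le_iff split: if_splits)
    qed
    have "\<bar>\<Sum>s\<in>V. Q i j - r' i j (x (Suc s)) - 0 - \<gamma> * vmax Q (x (Suc s))\<bar> \<le> real (card V) * ((1 + \<gamma>) * \<epsilon>bar)"
      using sum_norm_bound[OF term_bound[folded real_norm_def]] by simp
    then have "\<bar>mean_deviation \<gamma> r' Q x u (\<lambda>_. 0) t i j\<bar> \<le> (1 + \<gamma>) * \<epsilon>bar"
      using V unfolding mean_deviation_def V_def[symmetric] by (simp add: field_simps)
    then show False using large by simp
  qed
  define M :: "'w measure" where "M = return (count_space UNIV) undefined"
  interpret prob_space M unfolding M_def by (rule prob_space_return) simp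
  \<comment> \<open>Only training length 0 gets the bad estimate; later ones are exact, so the error
    bounds tend to 0 as \<open>learned_estimates\<close> demands. The guarantee speaks of each
    single \<open>ta\<close>, hence of \<open>ta = 0\<close>.\<close>
  define Qhat where "Qhat n = (\<lambda>_ :: 'w. if n = (0::nat) then Q else (\<lambda>_ _. 0))" for n
  define \<epsilon> where "\<epsilon> n = (if n = (0::nat) then \<epsilon>bar else 0)" for n
  have est: "estimate_ok (Qstar \<gamma> p' r') (Qhat n \<omega>) (\<epsilon> n)" for n \<omega>
    using \<open>0 \<le> \<epsilon>bar\<close> by (simp add: estimate_ok_def Qstar Qhat_def Q_def \<epsilon>_def)
  have Qhat_measurable: "(\<lambda>\<omega>. Qhat n \<omega> i j) \<in> borel_measurable M" for n i j
    by (simp add: Qhat_def)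
  have "\<epsilon> \<longlonglongrightarrow> 0"
    by (intro tendsto_eventually eventually_sequentiallyI[of 1]) (simp add: \<epsilon>_def)
  then have learned: "learned_estimates M (Qstar \<gamma> p' r') Qhat \<epsilon>"
    unfolding learned_estimates_def using Qhat_measurable by (simp add: est prob_space)
  have process: "controlled_process phat' (return borel 0) M (\<lambda>_. M) (\<lambda>s _. x s) (\<lambda>s _. u s) (\<lambda>_ _. 0)"
    unfolding M_def by (rule controlled_process_deterministic) (auto simp: phat'_def x_def)
  have "\<not> breach_guarantee TYPE('w) \<gamma> p' r' phat' \<epsilon>bar"
  proof
    let ?P = "\<lambda>tc. \<P>(\<omega> in M. declares_breach \<gamma> r' ((1 + \<gamma>) * \<epsilon>bar) (Qhat 0 \<omega>) x u (\<lambda>_. 0) tc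
      \<bar> estimate_ok (Qstar \<gamma> p' r') (Qhat 0 \<omega>) (\<epsilon> 0))"
    assume "breach_guarantee TYPE('w) \<gamma> p' r' phat' \<epsilon>bar"
    note guarantee = this[unfolded breach_guarantee_def, rule_format, where F="\<lambda>_. M" and ta=0,
        OF zero_mean_noise_zero learned Qhat_measurable]
    have "\<P>(\<omega> in M. estimate_ok (Qstar \<gamma> p' r') (Qhat 0 \<omega>) (\<epsilon> 0)) > 0"
      by (simp add: est prob_space)
    moreover have "\<epsilon> 0 \<le> \<epsilon>bar" by (simp add: \<epsilon>_def)
    ultimately have "?P \<longlonglongrightarrow> 1"
      using conjunct1[OF guarantee] process by blast
    moreover have "?P \<longlonglongrightarrow> 0"
      by (intro tendsto_eventually eventually_sequentiallyI[of 1])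
         (simp add: cond_prob_def Qhat_def undetected)
    ultimately have "(1 :: real) = 0" by (rule LIMSEQ_unique)
    then show False by simp
  qed
  then show thesis using that Phi by (simp add: \<phi>_def)
qed

text \<open>The condition sees an instance only through \<open>Phi_min\<close>, so the guarantee is
  asked of all instances sharing that value: sufficiency covers each of them, necessity exhibits one
  that fails. In a particular instance the permitted errors may be unable to shift a deviation by
  the full \<open>(1 + \<gamma>) * \<epsilon>bar\<close>; necessity is therefore a worst-case
  statement.\<close>

theorem theorem5:
  fixes p phat :: "('x::finite, 'u::finite) kernel"
    and r :: "('x, 'u) rewards"
    and \<gamma> \<epsilon>bar :: real
  assumes "0 \<le> \<gamma>" and "\<gamma> < 1"
  shows "Phi_min \<gamma> p r phat > 2 * (1 + \<gamma>) * \<epsilon>bar \<longleftrightarrow>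
    (\<forall>(p' :: ('x, 'u) kernel) r' phat'.
       Phi_min \<gamma> p' r' phat' = Phi_min \<gamma> p r phat \<longrightarrow>
       breach_guarantee TYPE('w) \<gamma> p' r' phat' \<epsilon>bar)"
proof
  assume adv: "Phi_min \<gamma> p r phat > 2 * (1 + \<gamma>) * \<epsilon>bar"
  show "\<forall>(p' :: ('x, 'u) kernel) r' phat'. Phi_min \<gamma> p' r' phat' = Phi_min \<gamma> p r phat \<longrightarrow>
      breach_guarantee TYPE('w) \<gamma> p' r' phat' \<epsilon>bar"
    using information_advantage_sufficient[OF assms] adv by metis
next
  assume guarantee: "\<forall>(p' :: ('x, 'u) kernel) r' phat'. Phi_min \<gamma> p' r' phat' = Phi_min \<gamma> p r phat \<longrightarrow>
      breach_guarantee TYPE('w) \<gamma> p' r' phat' \<epsilon>bar"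
  show "Phi_min \<gamma> p r phat > 2 * (1 + \<gamma>) * \<epsilon>bar"
  proof (rule ccontr)
    assume "\<not> ?thesis"
    then have "Phi_min \<gamma> p r phat \<le> 2 * (1 + \<gamma>) * \<epsilon>bar" by simp
    then show False
      by (rule information_advantage_necessary[OF assms, where 'w='w]) (use guarantee in blast)
  qed
qed

end
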